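(* Let $L\subseteq\mathbb{R}^n$ be an $n$-dimensional lattice and suppose that $(C,z)$ is feasible for the primal program (P) for $L$. Then $$C \ge c_2(\mathbb{R}^n/L)^2 \ge \sup\Big\{ 2\pi^2\int_{V(L)}|x|^2\,d\nu(x) : \nu\in\mathcal{M}_+(V(L)),\ Y\in\mathcal{S}^n_+,\ \mathrm{Tr}(Y)=1,\ \int_{V(L)}(1-\cos(2\pi u^{\mathsf T}x))\,d\nu(x)\le u^{\mathsf T}Yu \text{ for all } u\in L^*\Big\}.$$ Moreover, for $(\nu,Y)$ feasible for the maximization problem on the right-hand side, equality holds throughout for $(\nu,Y)$, i.e. $C=2\pi^2\int_{V(L)}|x|^2\,d\nu(x)$, if and only if the following three conditions hold: (i) $\left(CI-4\pi^2\sum_{u\in L^*}z(u)\,uu^{\mathsf T}\right)Y=0$; (ii) the measure $\nu$ is supported only on vectors $x\in V(L)$ for which $|x|^2=2\sum_{u\in L^*}z(u)(1-\cos(2\pi u^{\mathsf T}x))$; (iii) for all $u\in L^*$ with $z(u)\neq0$, $\int_{V(L)}(1-\cos(2\pi u^{\mathsf T}x))\,d\nu(x)=u^{\mathsf T}Yu$.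
   Context: An $n$-dimensional lattice $L\subseteq\mathbb{R}^n$ is the set of all integral linear combinations of a basis of $\mathbb{R}^n$; $|x|=\sqrt{x^{\mathsf T}x}$. The flat torus $\mathbb{R}^n/L$ has the metric $d_{\mathbb{R}^n/L}(x,y)=\min_{v\in L}|x-y-v|$. The dual lattice is $L^*=\{u\in\mathbb{R}^n: u^{\mathsf T}v\in\mathbb{Z}\text{ for all }v\in L\}$. The Voronoi cell is $V(L)=\{x\in\mathbb{R}^n: |x|\le|x-v|\text{ for all }v\in L\}$. A Euclidean embedding of $\mathbb{R}^n/L$ is an injective function $\varphi:\mathbb{R}^n/L\to H$ into some (complex) Hilbert space $H$. Its distortion is $$\mathrm{dist}(\varphi)=\sup_{x\ne y}\frac{\|\varphi(x)-\varphi(y)\|}{d_{\mathbb{R}^n/L}(x,y)}\cdot\sup_{x\neq y}\frac{d_{\mathbb{R}^n/L}(x,y)}{\|\varphi(x)-\varphi(y)\|},$$ with suprema over distinct $x,y\in\mathbb{R}^n/L$. The least (Euclidean) distortion is $c_2(\mathbb{R}^n/L)=\inf\{\mathrm{dist}(\varphi)\}$ over all Euclidean embeddings $\varphi$ of $\mathbb{R}^n/L$ into Hilbert spaces. $\ell^1(L^* )=\{z:L^*\to\mathbb{C}:\sum_{u\in L^*}|z(u)|<\infty\}$; $\mathbb{R}_+$ denotes the nonnegative reals; $I$ is the $n\times n$ identity matrix; $\mathcal{S}^n_+$ is the cone of real symmetric positive semidefinite $n\times n$ matrices; $\mathcal{M}_+(V(L))$ is the cone of (nonnegative) Borel measures supported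 on $V(L)$. Primal program (P) for $L$: minimize $C$ subject to $C\in\mathbb{R}_+$, $z\in\ell^1(L^* )$, $z(u)=z(-u)\ge0$ for all $u\in L^*$, $|x|^2\le2\sum_{u\in L^*}z(u)(1-\cos(2\pi u^{\mathsf T}x))$ for all $x\in V(L)$, and $CI-4\pi^2\sum_{u\in L^*}z(u)uu^{\mathsf T}\in\mathcal{S}^n_+$ (the last constraint includes convergence of the series). A pair $(C,z)$ is feasible if it satisfies all these constraints. *)

theory Defs
  imports "HOL-Analysis.Analysis" "HOL-Algebra.Module" "HOL-Decision_Procs.Algebra_Aux"
begin

section \<open>Lattices and flat tori\<close>

definition is_lattice :: "(real^'n) set \<Rightarrow> bool" where
  "is_lattice L \<longleftrightarrow> (\<exists>B. independent B \<and> span B = UNIV \<and>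
     L = {(\<Sum>b\<in>B. real_of_int (c b) *\<^sub>R b) | c. True})"

definition dual_lattice :: "(real^'n) set \<Rightarrow> (real^'n) set" where
  "dual_lattice L = {u. \<forall>v\<in>L. u \<bullet> v \<in> \<int>}"

definition voronoi_cell :: "(real^'n) set \<Rightarrow> (real^'n) set" where
  "voronoi_cell L = {x. \<forall>v\<in>L. norm x \<le> norm (x - v)}"

definition torus_rel :: "(real^'n) set \<Rightarrow> ((real^'n) \<times> (real^'n)) set" where
  "torus_rel L = {(x, y). x - y \<in> L}"

definition torus :: "(real^'n) set \<Rightarrow> (real^'n) set set" where
  "torus L = UNIV // torus_rel L"

text \<open>The infimum is a minimum because a lattice is discrete; the choice of representatives
  is irrelevant, see \<open>torus_dist_class\<close> below.\<close>

definition torus_dist :: "(real^'n) set \<Rightarrow> (real^'n) set \<Rightarrow> (real^'n) set \<Rightarrow> real" where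
  "torus_dist L X Y = (INF v\<in>L. norm ((SOME x. x \<in> X) - (SOME y. y \<in> Y) - v))"

lemma lattice_zero: "is_lattice L \<Longrightarrow> 0 \<in> L"
  unfolding is_lattice_def by (force intro: exI[of _ "\<lambda>_. 0"])

lemma lattice_diff:
  assumes "is_lattice L" "x \<in> L" "y \<in> L"
  shows "x - y \<in> L"
proof -
  obtain B where L: "L = {(\<Sum>b\<in>B. real_of_int (c b) *\<^sub>R b) | c. True}"
    using assms(1) unfolding is_lattice_def by blast
  obtain c d where "x = (\<Sum>b\<in>B. real_of_int (c b) *\<^sub>R b)" "y = (\<Sum>b\<in>B. real_of_int (d b) *\<^sub>R b)"
    using assms(2,3) unfolding L by blast
  then have "x - y = (\<Sum>b\<in>B. real_of_int (c b - d b) *\<^sub>R b)"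
    by (simp add: sum_subtractf scaleR_left_diff_distrib)
  then show ?thesis
    unfolding L by (auto intro!: exI[of _ "\<lambda>b. c b - d b"])
qed

lemma lattice_add: "is_lattice L \<Longrightarrow> x \<in> L \<Longrightarrow> y \<in> L \<Longrightarrow> x + y \<in> L"
  using lattice_diff[of L x "0 - y"] lattice_diff[of L 0 y] lattice_zero[of L] by simp

lemma equiv_torus_rel:
  assumes "is_lattice L"
  shows "equiv UNIV (torus_rel L)"
proof (rule equivI)
  show "refl (torus_rel L)"
    using lattice_zero[OF assms] by (auto simp: refl_on_def torus_rel_def)
  show "sym (torus_rel L)"
    using lattice_diff[OF assms lattice_zero[OF assms]]
    by (force simp: sym_def torus_rel_def)
  show "trans (torus_rel L)"
    using lattice_add[OF assms] by (fastforce simp: trans_def torus_rel_def)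
qed simp

lemma torus_dist_class:
  assumes L: "is_lattice L"
  shows "torus_dist L (torus_rel L `` {x}) (torus_rel L `` {y}) = (INF v\<in>L. norm (x - y - v))"
proof -
  have rep: "z - (SOME w. w \<in> torus_rel L `` {z}) \<in> L" for z
  proof -
    have "(SOME w. w \<in> torus_rel L `` {z}) \<in> torus_rel L `` {z}"
      by (rule someI[of _ z]) (use lattice_zero[OF L] in \<open>simp add: torus_rel_def\<close>)
    then show ?thesis by (simp add: torus_rel_def)
  qed
  define x' where "x' = (SOME w. w \<in> torus_rel L `` {x})"
  define y' where "y' = (SOME w. w \<in> torus_rel L `` {y})"
  define t where "t = (x - x') - (y - y')"
  have t: "t \<in> L"
    unfolding t_def x'_def y'_def by (intro lattice_diff[OF L] rep)
  have "(\<lambda>v. norm (x - y - v)) ` L = (\<lambda>v. norm (x' - y' - v)) ` L"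
  proof (intro equalityI image_subsetI)
    fix v assume "v \<in> L"
    then show "norm (x - y - v) \<in> (\<lambda>v. norm (x' - y' - v)) ` L"
      by (intro image_eqI[of _ _ "v - t"] lattice_diff[OF L _ t]) (auto simp: t_def algebra_simps)
  next
    fix v assume "v \<in> L"
    then show "norm (x' - y' - v) \<in> (\<lambda>v. norm (x - y - v)) ` L"
      by (intro image_eqI[of _ _ "v + t"] lattice_add[OF L _ t]) (auto simp: t_def algebra_simps)
  qed
  then show ?thesis
    by (simp add: torus_dist_def x'_def y'_def)
qed


section \<open>Complex Hilbert spaces\<close>

text \<open>Hilbert spaces are structures on a carrier set, so that one can take an infimum over all
  of them (inside a given type). The ring \<open>cring_class_ops\<close> at type \<^typ>\<open>complex\<close> is the field
  of complex numbers. The ring multiplication and unit of the underlying record are not used.\<close>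

record 'h cinner_space = "(complex, 'h) module" +
  cinner :: "'h \<Rightarrow> 'h \<Rightarrow> complex"

definition cnorm :: "'h cinner_space \<Rightarrow> 'h \<Rightarrow> real" where
  "cnorm H x = sqrt (Re (cinner H x x))"

locale complex_hilbert_space = module "cring_class_ops :: complex ring" H
  for H :: "'h cinner_space" (structure) +
  assumes cinner_add:
      "\<lbrakk>x \<in> carrier H; y \<in> carrier H; w \<in> carrier H\<rbrakk>
        \<Longrightarrow> cinner H (x \<oplus> y) w = cinner H x w + cinner H y w"
    and cinner_smult:
      "\<lbrakk>x \<in> carrier H; w \<in> carrier H\<rbrakk> \<Longrightarrow> cinner H (a \<odot> x) w = a * cinner H x w"
    and cinner_commute:
      "\<lbrakk>x \<in> carrier H; y \<in> carrier H\<rbrakk> \<Longrightarrow> cinner H x y = cnj (cinner H y x)"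
    and cinner_nonneg: "x \<in> carrier H \<Longrightarrow> 0 \<le> Re (cinner H x x)"
    and cinner_definite: "\<lbrakk>x \<in> carrier H; cinner H x x = 0\<rbrakk> \<Longrightarrow> x = \<zero>"
    and complete:
      "\<lbrakk>\<forall>k. f k \<in> carrier H;
        \<forall>\<epsilon>>0. \<exists>N. \<forall>k\<ge>N. \<forall>m\<ge>N. cnorm H (f k \<ominus> f m) < \<epsilon>\<rbrakk>
        \<Longrightarrow> \<exists>x\<in>carrier H. (\<lambda>k. cnorm H (f k \<ominus> x)) \<longlonglongrightarrow> 0"


section \<open>Least distortion\<close>

definition euclidean_embedding ::
    "(real^'n) set \<Rightarrow> 'h cinner_space \<Rightarrow> ((real^'n) set \<Rightarrow> 'h) \<Rightarrow> bool" where
  "euclidean_embedding L H \<phi> \<longleftrightarrow>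
     complex_hilbert_space H \<and> \<phi> \<in> torus L \<rightarrow> carrier H \<and> inj_on \<phi> (torus L)"

definition distortion ::
    "(real^'n) set \<Rightarrow> 'h cinner_space \<Rightarrow> ((real^'n) set \<Rightarrow> 'h) \<Rightarrow> ennreal" where
  "distortion L H \<phi> =
     (SUP (X, Y) \<in> {(X, Y). X \<in> torus L \<and> Y \<in> torus L \<and> X \<noteq> Y}.
        ennreal (cnorm H (\<phi> X \<ominus>\<^bsub>H\<^esub> \<phi> Y) / torus_dist L X Y)) *
     (SUP (X, Y) \<in> {(X, Y). X \<in> torus L \<and> Y \<in> torus L \<and> X \<noteq> Y}.
        ennreal (torus_dist L X Y / cnorm H (\<phi> X \<ominus>\<^bsub>H\<^esub> \<phi> Y)))"

text \<open>HOL cannot quantify over types inside a formula, so the infimum ranges over all Hilbert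
  spaces whose elements belong to the type \<^typ>\<open>'h\<close>. As soon as \<^typ>\<open>'h\<close> has at least the
  cardinality of the continuum the value is independent of \<^typ>\<open>'h\<close>: an embedding of finite
  distortion is continuous, hence the closed linear span of its image is a separable Hilbert space,
  and this has at most continuum many elements.\<close>

definition least_distortion :: "'h itself \<Rightarrow> (real^'n) set \<Rightarrow> ennreal" where
  "least_distortion _ L =
     Inf {distortion L H \<phi> | (H :: 'h cinner_space) \<phi>. euclidean_embedding L H \<phi>}"


section \<open>The primal and dual programs\<close>

definition psd :: "real^'n^'n \<Rightarrow> bool" where
  "psd A \<longleftrightarrow> transpose A = A \<and> (\<forall>x. 0 \<le> x \<bullet> (A *v x))"

definition outer :: "real^'n \<Rightarrow> real^'n^'n" where
  "outer u = (\<chi> i j. u $ i * u $ j)"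

definition cos_series :: "(real^'n) set \<Rightarrow> (real^'n \<Rightarrow> real) \<Rightarrow> real^'n \<Rightarrow> real" where
  "cos_series L z x = 2 * (\<Sum>\<^sub>\<infinity>u\<in>dual_lattice L. z u * (1 - cos (2 * pi * (u \<bullet> x))))"

definition slack_matrix :: "(real^'n) set \<Rightarrow> real \<Rightarrow> (real^'n \<Rightarrow> real) \<Rightarrow> real^'n^'n" where
  "slack_matrix L C z =
     C *\<^sub>R mat 1 - (4 * pi\<^sup>2) *\<^sub>R (\<Sum>\<^sub>\<infinity>u\<in>dual_lattice L. z u *\<^sub>R outer u)"

text \<open>Since all values of a feasible \<open>z\<close> are nonnegative, \<open>z\<close> is taken real-valued; only its
  restriction to the dual lattice matters.\<close>

definition primal_feasible :: "(real^'n) set \<Rightarrow> real \<Rightarrow> (real^'n \<Rightarrow> real) \<Rightarrow> bool" where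
  "primal_feasible L C z \<longleftrightarrow>
     0 \<le> C \<and>
     (\<lambda>u. \<bar>z u\<bar>) summable_on dual_lattice L \<and>
     (\<forall>u\<in>dual_lattice L. z u = z (- u) \<and> 0 \<le> z u) \<and>
     (\<forall>x\<in>voronoi_cell L. (norm x)\<^sup>2 \<le> cos_series L z x) \<and>
     (\<lambda>u. z u *\<^sub>R outer u) summable_on dual_lattice L \<and>
     psd (slack_matrix L C z)"

definition supported_on :: "'a measure \<Rightarrow> 'a set \<Rightarrow> bool" where
  "supported_on \<nu> S \<longleftrightarrow> (AE x in \<nu>. x \<in> S)"

text \<open>Integrals of nonnegative functions are taken in \<^typ>\<open>ennreal\<close>, so that they are meaningful
  for every Borel measure; in particular finiteness of \<open>\<nu>\<close> need not be assumed.\<close>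

definition dual_feasible :: "(real^'n) set \<Rightarrow> (real^'n) measure \<Rightarrow> real^'n^'n \<Rightarrow> bool" where
  "dual_feasible L \<nu> Y \<longleftrightarrow>
     sets \<nu> = sets borel \<and> supported_on \<nu> (voronoi_cell L) \<and>
     psd Y \<and> trace Y = 1 \<and>
     (\<forall>u\<in>dual_lattice L.
        (\<integral>\<^sup>+x\<in>voronoi_cell L. ennreal (1 - cos (2 * pi * (u \<bullet> x))) \<partial>\<nu>) \<le> ennreal (u \<bullet> (Y *v u)))"

definition dual_value :: "(real^'n) set \<Rightarrow> (real^'n) measure \<Rightarrow> ennreal" where
  "dual_value L \<nu> = ennreal (2 * pi\<^sup>2) * (\<integral>\<^sup>+x\<in>voronoi_cell L. ennreal ((norm x)\<^sup>2) \<partial>\<nu>)"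

end

theory Submission
  imports Defs "HOL-Complex_Analysis.Great_Picard"
begin

text \<open>
  A feasible \<open>z\<close> is an embedding in disguise. The map
  \<open>x \<mapsto> (sqrt (z u) * exp (2 \<pi> i u\<^bold>\<cdot>x))\<close>, indexed by the dual lattice, sends the torus into
  \<open>\<ell>\<^sup>2\<close>, and the square of the distance of the images of \<open>x\<close> and \<open>y\<close> is the cosine series of \<open>z\<close> at
  \<open>x - y\<close>. After translating \<open>x - y\<close> into the Voronoi cell, the norm constraint makes this series
  at least the squared torus distance, and \<open>1 - cos t \<le> t\<^sup>2 / 2\<close> together with the matrix constraint makes it at
  most \<open>C\<close> times the squared torus distance. So the least distortion is at most \<open>sqrt C\<close>
  (\<open>least_distortion_le_primal\<close>).

  Conversely, every embedding of finite distortion produces a feasible point of the primal program whose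
  value is the square of its distortion (\<open>embedding_imp_primal_feasible\<close>), so that the lower bound becomes
  weak duality for that point. To find the point, average \<open>\<parallel>\<phi>(y + x) - \<phi>(y)\<parallel>\<^sup>2\<close> over \<open>y\<close>. The average
  inherits both distortion bounds, and it is a cosine series with nonnegative coefficients because the Gram
  kernel \<open>Re \<langle>\<phi>(x), \<phi>(y)\<rangle>\<close> is positive semidefinite. The expansion is not taken on the torus itself:
  for odd \<open>M\<close> the average over the subgroup \<open>(1/M)L / L\<close> is a finite sum, and discrete
  Fourier inversion on \<open>(\<int>/M)\<^sup>n\<close> gives the cosine expansion on that subgroup exactly
  (\<open>grid_mean_square_difference\<close>). The Lipschitz bound at the \<open>n\<close> grid steps along the lattice basis bounds the second moment of
  the coefficients uniformly in \<open>M\<close>; hence no mass escapes to infinity, and a subsequence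
  converges to the required coefficients (\<open>periodic_kernel_spectrum\<close>).

  Weak duality and the equality conditions (\<open>weak_duality_complementary_slackness\<close>) come from the chain
  \<open>2\<pi>\<^sup>2 \<integral> |x|\<^sup>2 d\<nu> \<le> 2\<pi>\<^sup>2 \<integral> 2 \<Sum> z(u) (1 - cos (2 \<pi> u\<^bold>\<cdot>x)) d\<nu> \<le> 4\<pi>\<^sup>2 \<Sum> z(u) u\<^sup>T Y u = C - Tr(S Y) \<le> C\<close>,
  where \<open>S\<close> is the slack matrix. All members are finite, so equality at the ends means equality in each
  step. The first step is tight when \<open>\<nu>\<close> lives on the points where the cosine series equals \<open>|x|\<^sup>2\<close>, the second
  when the constraint on \<open>(\<nu>, Y)\<close> is tight wherever \<open>z(u) \<noteq> 0\<close>, and the third when \<open>S Y = 0\<close>.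
\<close>

section \<open>Positive semidefinite matrices\<close>

lemma inner_matrix_symmetric:
  fixes A :: "real^'n^'n"
  assumes "transpose A = A"
  shows "x \<bullet> (A *v y) = y \<bullet> (A *v x)"
  by (metis assms dot_lmul_matrix inner_commute transpose_matrix_vector)

lemma outer_mult_vec: "outer u *v x = (u \<bullet> x) *\<^sub>R u"
  by (simp add: vec_eq_iff outer_def matrix_vector_mult_def inner_vec_def sum_distrib_left
      sum_distrib_right mult_ac)

lemma inner_outer: "x \<bullet> (outer u *v x) = (u \<bullet> x)\<^sup>2"
  by (simp add: outer_mult_vec inner_commute power2_eq_square)

lemma transpose_outer [simp]: "transpose (outer u) = outer u"
  by (simp add: transpose_def outer_def vec_eq_iff mult.commute)

text \<open>The quadratic form is nonnegative on the line \<open>x + t y\<close>, so as a polynomial in \<open>t\<close> it has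
  nonpositive discriminant. The form may be degenerate, hence the separate case \<open>y\<^sup>T A y = 0\<close>.\<close>

lemma psd_Cauchy_Schwarz:
  assumes "psd A"
  shows "(x \<bullet> (A *v y))\<^sup>2 \<le> (x \<bullet> (A *v x)) * (y \<bullet> (A *v y))"
proof -
  define a b c where abc: "a = x \<bullet> (A *v x)" "b = x \<bullet> (A *v y)" "c = y \<bullet> (A *v y)"
  have sym: "y \<bullet> (A *v x) = b"
    using assms by (auto simp: abc psd_def intro: inner_matrix_symmetric)
  have q: "0 \<le> a + 2 * t * b + t\<^sup>2 * c" for t
  proof -
    have "0 \<le> (x + t *\<^sub>R y) \<bullet> (A *v (x + t *\<^sub>R y))"
      using assms by (auto simp: psd_def)
    also have "\<dots> = a + 2 * t * b + t\<^sup>2 * c"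
      by (simp add: abc[symmetric] sym matrix_vector_right_distrib matrix_vector_mult_scaleR
          algebra_simps power2_eq_square)
    finally show ?thesis .
  qed
  have c0: "0 \<le> c" using assms by (auto simp: abc psd_def)
  show ?thesis
  proof (cases "c = 0")
    case True
    have "b = 0"
    proof (rule ccontr)
      assume "b \<noteq> 0"
      then show False using q[of "- (a + 1) / (2 * b)"] True by (simp add: field_simps)
    qed
    then show ?thesis using True by (simp add: abc)
  next
    case False
    have "0 \<le> a + 2 * (- b / c) * b + (- b / c)\<^sup>2 * c" by (rule q)
    also have "\<dots> = a - b\<^sup>2 / c" using False by (simp add: field_simps power2_eq_square)
    finally have "b\<^sup>2 \<le> a * c" using c0 False by (simp add: field_simps)
    then show ?thesis by (simp add: abc)
  qed
qed

lemma psd_isotropic_imp_kernel: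
  assumes "psd A" "x \<bullet> (A *v x) = 0"
  shows "A *v x = 0"
proof -
  have "((A *v x) \<bullet> (A *v x))\<^sup>2 \<le> 0"
    using psd_Cauchy_Schwarz[OF assms(1), of "A *v x" x] assms(2) by simp
  then show ?thesis by simp
qed

lemma matrix_entry_inner: "(A :: real^'n^'n) $ i $ j = axis i 1 \<bullet> (A *v axis j 1)"
  by (simp add: inner_axis' matrix_vector_mult_basis column_def)

text \<open>Elimination takes the place of the spectral theorem: subtracting
  \<open>v v\<^sup>T\<close> with \<open>v = Y e\<^sub>p / sqrt (Y\<^sub>p\<^sub>p)\<close> leaves a positive semidefinite matrix by Cauchy-Schwarz, kills
  the diagonal entry at \<open>p\<close> and keeps the diagonal entries that are already zero. A positive
  semidefinite matrix with zero diagonal vanishes.\<close>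

lemma psd_sum_outer:
  fixes Y :: "real^'n^'n"
  assumes "psd Y"
  shows "\<exists>(w :: nat \<Rightarrow> real^'n) k. Y = (\<Sum>i<k. outer (w i))"
  using assms
proof (induction "card {i. Y $ i $ i \<noteq> 0}" arbitrary: Y rule: less_induct)
  case less
  note psd = less.prems
  have diag: "0 \<le> Y $ i $ i" for i
    using psd by (auto simp: matrix_entry_inner psd_def)
  have CS: "(Y $ i $ j)\<^sup>2 \<le> Y $ i $ i * Y $ j $ j" for i j
    using psd_Cauchy_Schwarz[OF psd] by (simp add: matrix_entry_inner)
  show ?case
  proof (cases "\<forall>i. Y $ i $ i = 0")
    case True
    then have "Y $ i $ j = 0" for i j
      using CS[of i j] by simp
    then have "Y = (\<Sum>i<(0::nat). outer (0 :: real^'n))"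
      by (simp add: vec_eq_iff)
    then show ?thesis by (intro exI)
  next
    case False
    then obtain p where p: "Y $ p $ p \<noteq> 0" by blast
    then have pp: "Y $ p $ p > 0" using diag[of p] by linarith
    define v where "v = (1 / sqrt (Y $ p $ p)) *\<^sub>R (Y *v axis p 1)"
    define Z where "Z = Y - outer v"
    have vx: "(v \<bullet> x)\<^sup>2 = (x \<bullet> (Y *v axis p 1))\<^sup>2 / Y $ p $ p" for x
      using pp by (simp add: v_def power_mult_distrib power_divide inner_commute)
    have Zx: "x \<bullet> (Z *v x) = x \<bullet> (Y *v x) - (v \<bullet> x)\<^sup>2" for x
      by (simp add: Z_def matrix_vector_mult_diff_rdistrib inner_diff_right inner_outer)
    have "psd Z"
      unfolding psd_def
    proof (intro conjI allI)
      show "transpose Z = Z"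
        using psd by (simp add: Z_def psd_def transpose_def outer_def vec_eq_iff mult.commute)
    next
      fix x
      have "(x \<bullet> (Y *v axis p 1))\<^sup>2 \<le> (x \<bullet> (Y *v x)) * Y $ p $ p"
        using psd_Cauchy_Schwarz[OF psd, of x "axis p 1"] by (simp add: matrix_entry_inner)
      then show "0 \<le> x \<bullet> (Z *v x)"
        unfolding Zx vx using pp by (simp add: field_simps)
    qed
    have Zd: "Z $ i $ i = Y $ i $ i - (v $ i)\<^sup>2" for i
      by (simp add: Z_def outer_def power2_eq_square)
    have vi: "(v $ i)\<^sup>2 = (Y $ i $ p)\<^sup>2 / Y $ p $ p" for i
      using vx[of "axis i 1"] by (simp add: matrix_entry_inner inner_axis)
    have "Z $ p $ p = 0" using pp by (simp add: Zd vi) (simp add: power2_eq_square)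
    moreover have "Z $ i $ i = 0" if "Y $ i $ i = 0" for i
      using CS[of i p] that by (simp add: Zd vi)
    ultimately have "{i. Z $ i $ i \<noteq> 0} \<subset> {i. Y $ i $ i \<noteq> 0}" using p by blast
    then have "card {i. Z $ i $ i \<noteq> 0} < card {i. Y $ i $ i \<noteq> 0}"
      by (intro psubset_card_mono) auto
    from less.hyps[OF this \<open>psd Z\<close>] obtain w k where "Z = (\<Sum>i<(k::nat). outer (w i))"
      by blast
    then have "Y = (\<Sum>i<Suc k. outer ((w(k := v)) i))"
      by (simp add: Z_def algebra_simps)
    then show ?thesis by blast
  qed
qed

lemma matrix_mult_outer: "(A :: real^'n^'n) ** outer w = (\<chi> i j. (A *v w) $ i * w $ j)"
  by (simp add: matrix_matrix_mult_def outer_def matrix_vector_mult_def sum_distrib_right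
      mult.assoc vec_eq_iff)

lemma matrix_mult_zero_right: "(A :: real^'n^'n) ** 0 = (0 :: real^'n^'n)"
  by (simp add: matrix_matrix_mult_def vec_eq_iff)

lemma matrix_mult_sum_right: "(A :: real^'n^'n) ** (\<Sum>i\<in>I. B i) = (\<Sum>i\<in>I. A ** B i)"
  by (induction I rule: infinite_finite_induct)
     (simp_all add: matrix_add_ldistrib matrix_mult_zero_right)

lemma trace_sum: "trace (\<Sum>i\<in>I. (B i :: real^'n^'n)) = (\<Sum>i\<in>I. trace (B i))"
  by (induction I rule: infinite_finite_induct) (auto simp: trace_add, auto simp: trace_def)

lemma trace_mult_outer: "trace ((A :: real^'n^'n) ** outer w) = w \<bullet> (A *v w)"
  by (simp add: matrix_mult_outer trace_def inner_vec_def mult.commute)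

lemma trace_mult_sum_outer:
  "trace ((A :: real^'n^'n) ** (\<Sum>i\<in>I. outer (w i))) = (\<Sum>i\<in>I. w i \<bullet> (A *v w i))"
  by (simp add: matrix_mult_sum_right trace_sum trace_mult_outer)

lemma psd_trace_mult_nonneg:
  assumes "psd A" "psd Y"
  shows "0 \<le> trace (A ** Y)"
proof -
  obtain w :: "nat \<Rightarrow> real^'a" and k where "Y = (\<Sum>i<k. outer (w i))" 
    using psd_sum_outer[OF assms(2)] by blast
  with assms(1) show ?thesis by (auto simp: trace_mult_sum_outer psd_def intro!: sum_nonneg)
qed

text \<open>With \<open>Y = \<Sum> w\<^sub>i w\<^sub>i\<^sup>T\<close> the trace of \<open>A Y\<close> is \<open>\<Sum> w\<^sub>i\<^sup>T A w\<^sub>i\<close>; if this sum of nonnegative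
  terms is zero, every \<open>w\<^sub>i\<close> lies in the kernel of \<open>A\<close>.\<close>

lemma psd_trace_mult_eq_0_iff:
  assumes "psd A" "psd Y"
  shows "trace (A ** Y) = 0 \<longleftrightarrow> A ** Y = 0"
proof
  obtain w :: "nat \<Rightarrow> real^'a" and k where Y: "Y = (\<Sum>i<k. outer (w i))" 
    using psd_sum_outer[OF assms(2)] by blast
  assume "trace (A ** Y) = 0"
  then have "(\<Sum>i<k. w i \<bullet> (A *v w i)) = 0"
    by (simp add: Y trace_mult_sum_outer)
  then have "w i \<bullet> (A *v w i) = 0" if "i < k" for i
    using assms(1) that by (subst (asm) sum_nonneg_eq_0_iff) (auto simp: psd_def)
  then have "A *v w i = 0" if "i < k" for i
    using that assms(1) by (intro psd_isotropic_imp_kernel) auto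
  then have "A ** outer (w i) = 0" if "i < k" for i
    using that by (simp add: matrix_mult_outer vec_eq_iff)
  then show "A ** Y = 0"
    by (simp add: Y matrix_mult_sum_right)
qed (simp add: trace_def)

section \<open>Lattices in coordinates\<close>

definition int_vectors :: "(real^'n) set" where
  "int_vectors = {v. \<forall>i. v $ i \<in> \<int>}"

lemma closed_int_vectors: "closed (int_vectors :: (real^'n) set)"
proof -
  have "closed {v :: real^'n. v $ i \<in> \<int>}" for i
    using continuous_closed_vimage[OF closed_Ints, of "\<lambda>v::real^'n. v $ i"]
    by (simp add: vimage_def)
  then have "closed (\<Inter>i. {v :: real^'n. v $ i \<in> \<int>})"
    by (intro closed_INT) auto
  moreover have "(\<Inter>i. {v :: real^'n. v $ i \<in> \<int>}) = int_vectors"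
    by (auto simp: int_vectors_def)
  ultimately show ?thesis by simp
qed

text \<open>\<open>T\<close> maps the standard basis to a lattice basis and \<open>S\<close> is its inverse transpose. In
  these coordinates \<open>L\<close> and its dual are both the integer vectors, and the pairing between them is the
  standard one.\<close>

lemma lattice_coordinates:
  fixes L :: "(real^'n) set"
  assumes "is_lattice L"
  obtains T S :: "real^'n \<Rightarrow> real^'n" where
    "linear T" "inj T" "surj T" "linear S" "inj S" "L = T ` int_vectors"
    "dual_lattice L = S ` int_vectors" "\<And>p q. S p \<bullet> T q = p \<bullet> q"
proof -
  obtain B where B: "independent B" "span B = UNIV"
    and L: "L = {(\<Sum>b\<in>B. real_of_int (c b) *\<^sub>R b) | c. True}"
    using assms unfolding is_lattice_def by blast
  have "card B = dim (UNIV :: (real^'n) set)"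
    using B by (metis dim_eq_card span_UNIV)
  then have "card B = card (UNIV :: 'n set)" by simp
  then obtain \<beta> :: "'n \<Rightarrow> real^'n" where \<beta>: "bij_betw \<beta> UNIV B"
    using independent_imp_finite[OF B(1)] finite_same_card_bij[of "UNIV :: 'n set" B] by auto
  define T where "T v = (\<Sum>i\<in>UNIV. v $ i *\<^sub>R \<beta> i)" for v :: "real^'n"
  have linT: "linear T"
    unfolding T_def
    by (intro linear_compose_sum ballI linearI)
       (auto simp: algebra_simps)
  have T_sum: "(\<Sum>b\<in>B. f b *\<^sub>R b) = T (\<chi> i. f (\<beta> i))" for f
    unfolding T_def using sum.reindex_bij_betw[OF \<beta>, of "\<lambda>b. f b *\<^sub>R b"] by simp
  have surjT: "surj T"
  proof -
    have "y \<in> range T" for y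
    proof -
      have "y \<in> span B" using B by simp
      then obtain f where "y = (\<Sum>b\<in>B. f b *\<^sub>R b)"
        using span_finite[OF independent_imp_finite[OF B(1)]] by auto
      then show ?thesis by (simp add: T_sum)
    qed
    then show ?thesis by blast
  qed
  have injT: "inj T"
    using linear_surjective_imp_injective[OF linT surjT] by simp
  have LT: "L = T ` int_vectors"
  proof (intro equalityI subsetI)
    fix x assume "x \<in> L"
    then obtain c where "x = (\<Sum>b\<in>B. real_of_int (c b) *\<^sub>R b)" unfolding L by blast
    then show "x \<in> T ` int_vectors"
      by (auto simp: T_sum int_vectors_def)
  next
    fix x assume "x \<in> T ` int_vectors"
    then obtain v where v: "x = T v" "\<And>i. v $ i \<in> \<int>" by (auto simp: int_vectors_def)
    define c where "c b = \<lfloor>v $ (inv_into UNIV \<beta> b)\<rfloor>" for b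
    have "inv_into UNIV \<beta> (\<beta> i) = i" for i
      using \<beta> by (simp add: bij_betw_def)
    then have "(\<chi> i. real_of_int (c (\<beta> i))) = v"
      using v by (simp add: c_def vec_eq_iff)
    then have "x = (\<Sum>b\<in>B. real_of_int (c b) *\<^sub>R b)"
      by (simp add: T_sum v)
    then show "x \<in> L" unfolding L by blast
  qed
  have linA: "linear (adjoint T)" by (rule adjoint_linear[OF linT])
  have injA: "inj (adjoint T)"
  proof (rule injI)
    fix x y assume "adjoint T x = adjoint T y"
    then have "x \<bullet> T q = y \<bullet> T q" for q
      by (metis adjoint_works[OF linT] inner_commute)
    then have "x \<bullet> w = y \<bullet> w" for w using surjT by (metis surjD)
    then show "x = y" by (metis inner_eq_zero_iff inner_diff_left right_minus_eq)
  qed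
  have surjA: "surj (adjoint T)"
    using linear_injective_imp_surjective[OF linA injA] by simp
  define S where "S = inv_into UNIV (adjoint T)"
  have AS: "adjoint T (S p) = p" for p by (simp add: S_def surj_f_inv_f[OF surjA])
  have SA: "S (adjoint T u) = u" for u by (simp add: S_def inv_f_f[OF injA])
  have ST: "S p \<bullet> T q = p \<bullet> q" for p q
    using adjoint_works[OF linT, of q "S p"] by (simp add: AS inner_commute)
  have linS: "linear S"
  proof (rule linearI)
    fix x y c
    show "S (x + y) = S x + S y"
      using SA[of "S x + S y"] by (simp add: linear_add[OF linA] AS)
    show "S (c *\<^sub>R x) = c *\<^sub>R S x"
      using SA[of "c *\<^sub>R S x"] by (simp add: linear_scale[OF linA] AS)
  qed
  have injS: "inj S" by (metis AS injI)
  have "dual_lattice L = S ` int_vectors"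
  proof (intro equalityI subsetI)
    fix u assume u: "u \<in> dual_lattice L"
    have "adjoint T u \<in> int_vectors"
      unfolding int_vectors_def
    proof (intro CollectI allI)
      fix i
      have "axis i 1 \<in> (int_vectors :: (real^'n) set)"
        by (simp add: int_vectors_def axis_def)
      then have "u \<bullet> T (axis i 1) \<in> \<int>"
        using u LT by (auto simp: dual_lattice_def)
      then show "adjoint T u $ i \<in> \<int>"
        using ST[of "adjoint T u" "axis i 1"] by (simp add: SA inner_axis)
    qed
    then show "u \<in> S ` int_vectors" using SA[of u] by (metis image_eqI)
  next
    fix u assume "u \<in> S ` int_vectors"
    then obtain p where p: "u = S p" "\<And>i. p $ i \<in> \<int>" by (auto simp: int_vectors_def)
    have "u \<bullet> T v \<in> \<int>" if "v \<in> int_vectors" for v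
      unfolding p(1) ST
      using that p(2) by (auto simp: inner_vec_def int_vectors_def intro!: Ints_sum Ints_mult)
    then show "u \<in> dual_lattice L" by (auto simp: dual_lattice_def LT)
  qed
  then show thesis using that linT injT surjT linS injS LT ST by blast
qed

lemma closed_lattice:
  assumes "is_lattice L"
  shows "closed L"
proof -
  obtain T S :: "real^'a \<Rightarrow> real^'a" where "linear T" "inj T" "L = T ` int_vectors"
    using lattice_coordinates[OF assms] by metis
  then show ?thesis
    using closed_injective_linear_image[OF closed_int_vectors, of T] by simp
qed

text \<open>A lattice is closed, so some lattice vector \<open>v\<close> is nearest to \<open>x\<close>; minimality of \<open>v\<close> says
  exactly that \<open>x - v\<close> lies in the Voronoi cell.\<close>

lemma voronoi_translate:
  assumes "is_lattice L"
  obtains v where "v \<in> L" "x - v \<in> voronoi_cell L"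
    "(INF w\<in>L. norm (x - w)) = norm (x - v)"
proof -
  obtain v where v: "v \<in> L" "\<And>w. w \<in> L \<Longrightarrow> dist x v \<le> dist x w"
    using distance_attains_inf[OF closed_lattice[OF assms]] lattice_zero[OF assms] by blast
  show thesis
  proof (rule that[OF v(1)])
    show "x - v \<in> voronoi_cell L"
      unfolding voronoi_cell_def
    proof (intro CollectI ballI)
      fix w assume "w \<in> L"
      then show "norm (x - v) \<le> norm (x - v - w)"
        using v(2)[OF lattice_add[OF assms v(1), of w]] by (simp add: dist_norm diff_diff_eq)
    qed
    show "(INF w\<in>L. norm (x - w)) = norm (x - v)"
      using v by (intro cInf_eq_minimum) (auto simp: dist_norm)
  qed
qed

lemma closed_voronoi_cell: "closed (voronoi_cell L)"
proof -
  have "voronoi_cell L = (\<Inter>v\<in>L. {x. norm x \<le> norm (x - v)})"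
    by (auto simp: voronoi_cell_def)
  then show ?thesis
    by (auto intro!: closed_INT closed_Collect_le continuous_intros)
qed

lemma int_vectors_conv_range: "(int_vectors :: (real^'n) set) = range (\<lambda>p. \<chi> i. real_of_int (p i))"
proof (intro equalityI subsetI)
  fix v :: "real^'n" assume v: "v \<in> int_vectors"
  show "v \<in> range (\<lambda>p. \<chi> i. real_of_int (p i))"
    by (rule image_eqI[of _ _ "\<lambda>i. \<lfloor>v $ i\<rfloor>"])
       (use v in \<open>simp_all add: int_vectors_def vec_eq_iff\<close>)
qed (auto simp: int_vectors_def)

lemma dual_lattice_countable_infinite:
  fixes L :: "(real^'n) set"
  assumes "is_lattice L"
  shows "countable (dual_lattice L)" "infinite (dual_lattice L)"
proof -
  obtain S :: "real^'n \<Rightarrow> real^'n" where S: "inj S" "dual_lattice L = S ` int_vectors"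
    using lattice_coordinates[OF assms] by metis
  have "countable (UNIV :: ('n \<Rightarrow> int) set)" by simp
  then show "countable (dual_lattice L)"
    unfolding S int_vectors_conv_range by (intro countable_image)
  have "inj (\<lambda>k::nat. (\<chi> i. real k) :: real^'n)"
    by (auto intro!: injI simp: vec_eq_iff)
  then have "infinite (range (\<lambda>k::nat. (\<chi> i. real k) :: real^'n))"
    by (rule range_inj_infinite)
  moreover have "range (\<lambda>k::nat. (\<chi> i. real k) :: real^'n) \<subseteq> int_vectors"
    by (auto simp: int_vectors_def)
  ultimately have "infinite (int_vectors :: (real^'n) set)" using finite_subset by blast
  then show "infinite (dual_lattice L)"
    unfolding S using S(1) by (simp add: finite_image_iff inj_on_subset)
qed

section \<open>Weak duality and complementary slackness\<close>

lemma one_minus_cos_bounds: "0 \<le> 1 - cos (x::real)" "1 - cos x \<le> 2" "1 - cos x \<le> x\<^sup>2 / 2"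
proof -
  show "0 \<le> 1 - cos x" "1 - cos x \<le> 2" using cos_le_one[of x] cos_ge_minus_one[of x] by linarith+
  have "1 - cos x = 2 * (sin (x/2))\<^sup>2"
    using cos_double_sin[of "x/2"] by simp
  also have "(sin (x/2))\<^sup>2 \<le> (x/2)\<^sup>2"
    by (rule abs_le_square_iff[THEN iffD1]) (rule abs_sin_x_le_abs_x)
  finally show "1 - cos x \<le> x\<^sup>2 / 2" by (simp add: power2_eq_square)
qed

lemma bounded_linear_trace_mult: "bounded_linear (\<lambda>A :: real^'n^'n. trace (A ** Y))"
  by (intro linear_conv_bounded_linear[THEN iffD1] linearI)
     (simp_all add: trace_def matrix_matrix_mult_def sum.distrib sum_distrib_left algebra_simps)

lemma bounded_linear_quadratic: "bounded_linear (\<lambda>A :: real^'n^'n. w \<bullet> (A *v w))"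
  by (intro linear_conv_bounded_linear[THEN iffD1] linearI)
     (simp_all add: matrix_vector_mult_add_rdistrib inner_add_right scaleR_matrix_vector_assoc[symmetric])

lemma trace_outer_mult: "trace (outer u ** (Y :: real^'n^'n)) = u \<bullet> (Y *v u)"
  by (simp add: trace_def matrix_matrix_mult_def outer_def inner_vec_def matrix_vector_mult_def
      sum_distrib_left mult_ac) (subst sum.swap, simp add: mult.left_commute)

text \<open>Apply the linear functional \<open>A \<mapsto> Tr(A Y)\<close> to the matrix series; its value at \<open>u u\<^sup>T\<close> is
  \<open>u\<^sup>T Y u\<close>, and the multiple of the identity contributes \<open>C\<close> since \<open>Tr Y = 1\<close>.\<close>

lemma slack_trace:
  assumes "primal_feasible L C z" "trace Y = 1"
  shows "((\<lambda>u. 4 * pi\<^sup>2 * z u * (u \<bullet> (Y *v u))) has_sum (C - trace (slack_matrix L C z ** Y)))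
           (dual_lattice L)"
proof -
  define Z where "Z = (\<Sum>\<^sub>\<infinity>u\<in>dual_lattice L. z u *\<^sub>R outer u)"
  interpret tr: bounded_linear "\<lambda>A :: real^'a^'a. trace (A ** Y)" by (rule bounded_linear_trace_mult)
  have "((\<lambda>u. z u *\<^sub>R outer u) has_sum Z) (dual_lattice L)"
    using assms(1) by (simp add: Z_def primal_feasible_def)
  then have "((\<lambda>u. z u * (u \<bullet> (Y *v u))) has_sum trace (Z ** Y)) (dual_lattice L)"
    using has_sum_bounded_linear[OF bounded_linear_trace_mult[of Y]]
    by (fastforce simp: tr.scaleR trace_outer_mult)
  then have "((\<lambda>u. 4 * pi\<^sup>2 * (z u * (u \<bullet> (Y *v u)))) has_sum (4 * pi\<^sup>2 * trace (Z ** Y)))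
      (dual_lattice L)"
    by (rule has_sum_cmult_right)
  moreover have "4 * pi\<^sup>2 * trace (Z ** Y) = C - trace (slack_matrix L C z ** Y)"
    using assms(2) by (simp add: slack_matrix_def Z_def[symmetric] tr.diff tr.scaleR)
  ultimately show ?thesis by (simp add: mult.assoc)
qed

lemma slack_quadratic:
  assumes "(\<lambda>u. z u *\<^sub>R outer u) summable_on dual_lattice L"
  shows "((\<lambda>u. 4 * pi\<^sup>2 * z u * (u \<bullet> w)\<^sup>2) has_sum (C * (norm w)\<^sup>2 - w \<bullet> (slack_matrix L C z *v w)))
           (dual_lattice L)"
proof -
  define Z where "Z = (\<Sum>\<^sub>\<infinity>u\<in>dual_lattice L. z u *\<^sub>R outer u)"
  interpret q: bounded_linear "\<lambda>A :: real^'a^'a. w \<bullet> (A *v w)" by (rule bounded_linear_quadratic)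
  have "((\<lambda>u. z u *\<^sub>R outer u) has_sum Z) (dual_lattice L)"
    using assms(1) by (simp add: Z_def)
  then have "((\<lambda>u. z u * (u \<bullet> w)\<^sup>2) has_sum (w \<bullet> (Z *v w))) (dual_lattice L)"
    using has_sum_bounded_linear[OF bounded_linear_quadratic[of w]]
    by (fastforce simp: q.scaleR inner_outer)
  then have "((\<lambda>u. 4 * pi\<^sup>2 * (z u * (u \<bullet> w)\<^sup>2)) has_sum (4 * pi\<^sup>2 * (w \<bullet> (Z *v w)))) (dual_lattice L)"
    by (rule has_sum_cmult_right)
  moreover have "4 * pi\<^sup>2 * (w \<bullet> (Z *v w)) = C * (norm w)\<^sup>2 - w \<bullet> (slack_matrix L C z *v w)"
    by (simp add: slack_matrix_def Z_def[symmetric] q.diff q.scaleR power2_norm_eq_inner)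
  ultimately show ?thesis by (simp add: mult.assoc)
qed

lemma cos_series_has_sum:
  assumes "(\<lambda>u. \<bar>z u\<bar>) summable_on dual_lattice L"
    and "\<And>u. u \<in> dual_lattice L \<Longrightarrow> 0 \<le> z u"
  shows "((\<lambda>u. 2 * (z u * (1 - cos (2 * pi * (u \<bullet> x))))) has_sum cos_series L z x) (dual_lattice L)"
proof -
  have "(\<lambda>u. \<bar>z u\<bar> * 2) summable_on dual_lattice L"
    using assms(1) by (rule summable_on_cmult_left)
  then have "(\<lambda>u. z u * (1 - cos (2 * pi * (u \<bullet> x)))) summable_on dual_lattice L"
    by (rule summable_on_comparison_test)
       (use assms(2) one_minus_cos_bounds in \<open>auto intro!: mult_mono\<close>)
  then show ?thesis
    unfolding cos_series_def by (intro has_sum_cmult_right has_sum_infsum)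
qed

text \<open>Used for \<open>\<nu>\<close>, and with counting measure on the naturals for the termwise comparison of two series.\<close>

lemma nn_integral_eq_imp_AE_eq:
  fixes f g :: "'a \<Rightarrow> ennreal"
  assumes [measurable]: "f \<in> borel_measurable M" "g \<in> borel_measurable M"
    and le: "AE x in M. f x \<le> g x" and eq: "integral\<^sup>N M f = integral\<^sup>N M g"
    and fin: "integral\<^sup>N M g < \<infinity>"
  shows "AE x in M. f x = g x"
proof -
  have "(\<integral>\<^sup>+x. g x - f x \<partial>M) = integral\<^sup>N M g - integral\<^sup>N M f"
    using le fin eq by (intro nn_integral_diff) auto
  also have "\<dots> = 0" using eq fin by (simp add: ennreal_diff_self)
  finally have "AE x in M. g x - f x = 0"
    by (subst (asm) nn_integral_0_iff_AE) auto
  moreover have "AE x in M. g x \<noteq> \<infinity>"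
    using fin by (intro nn_integral_PInf_AE) auto
  ultimately show ?thesis
    using le
  proof eventually_elim
    case (elim x)
    then have "g x \<le> f x"
      by (metis diff_gt_0_iff_gt_ennreal not_le less_irrefl)
    with elim show ?case by simp
  qed
qed

text \<open>In the proof the three numbers \<open>\<integral>N\<close>, \<open>\<integral>K\<close> and \<open>J\<close> are the members of the chain between the dual
  value and \<open>C\<close>. All integrals are in \<^typ>\<open>ennreal\<close>, so sum and integral commute by
  monotone convergence; the bound by \<open>C\<close> makes them finite, which is what allows equality of
  integrals to be turned into equality almost everywhere.\<close>

proposition weak_duality_complementary_slackness:
  fixes L :: "(real^'n) set"
  assumes L: "is_lattice L" and primal: "primal_feasible L C z" and dual: "dual_feasible L \<nu> Y"
  shows "dual_value L \<nu> \<le> ennreal C"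
    and "ennreal C = dual_value L \<nu> \<longleftrightarrow>
        slack_matrix L C z ** Y = 0 \<and>
        supported_on \<nu> {x \<in> voronoi_cell L. (norm x)\<^sup>2 = cos_series L z x} \<and>
        (\<forall>u\<in>dual_lattice L. z u \<noteq> 0 \<longrightarrow>
          (\<integral>\<^sup>+x\<in>voronoi_cell L. ennreal (1 - cos (2 * pi * (u \<bullet> x))) \<partial>\<nu>) = ennreal (u \<bullet> (Y *v u)))"
      (is "_ \<longleftrightarrow> ?c1 \<and> ?c2 \<and> ?c3")
proof -
  define V where "V = voronoi_cell L"
  define D where "D = dual_lattice L"
  define I where "I u = (\<integral>\<^sup>+x\<in>V. ennreal (1 - cos (2 * pi * (u \<bullet> x))) \<partial>\<nu>)" for u
  have C0: "0 \<le> C" and z0: "\<And>u. u \<in> D \<Longrightarrow> 0 \<le> z u"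
    and le_cos: "\<And>x. x \<in> V \<Longrightarrow> (norm x)\<^sup>2 \<le> cos_series L z x"
    and psdS: "psd (slack_matrix L C z)" and abs: "(\<lambda>u. \<bar>z u\<bar>) summable_on D"
    using primal by (auto simp: primal_feasible_def V_def D_def)
  have [measurable_cong]: "sets \<nu> = sets borel" and AEV: "AE x in \<nu>. x \<in> V"
    and psdY: "psd Y" and trY: "trace Y = 1"
    and I_le: "\<And>u. u \<in> D \<Longrightarrow> I u \<le> ennreal (u \<bullet> (Y *v u))"
    using dual by (auto simp: dual_feasible_def V_def D_def I_def supported_on_def)
  have [measurable]: "V \<in> sets \<nu>"
    using closed_voronoi_cell[of L] by (simp add: V_def \<open>sets \<nu> = sets borel\<close>)
  have Y0: "0 \<le> u \<bullet> (Y *v u)" for u using psdY by (simp add: psd_def)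

  define e where "e = from_nat_into D"
  have bij: "bij_betw e UNIV D"
    unfolding e_def D_def
    by (intro bij_betw_from_nat_into dual_lattice_countable_infinite[OF L])
  have eD: "e n \<in> D" for n using bij by (auto simp: bij_betw_def)
  define f where "f n x = ennreal (1 - cos (2 * pi * (e n \<bullet> x))) * indicator V x" for n x
  have [measurable]: "f n \<in> borel_measurable \<nu>" for n
    unfolding f_def by measurable
  define a where "a n = ennreal (4 * pi\<^sup>2 * z (e n))" for n
  define N where "N x = ennreal (2 * pi\<^sup>2 * (norm x)\<^sup>2) * indicator V x" for x :: "real^'n"
  define K where "K x = ennreal (2 * pi\<^sup>2 * cos_series L z x) * indicator V x" for x
  have K_sum: "K x = (\<Sum>n. a n * f n x)" for x
  proof (cases "x \<in> V")
    case True
    have "((\<lambda>u. 2 * (z u * (1 - cos (2 * pi * (u \<bullet> x))))) has_sum cos_series L z x) D"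
      unfolding D_def by (rule cos_series_has_sum) (use z0 abs in \<open>auto simp: D_def\<close>)
    then have "((\<lambda>u. 2 * pi\<^sup>2 * (2 * (z u * (1 - cos (2 * pi * (u \<bullet> x)))))) has_sum
        2 * pi\<^sup>2 * cos_series L z x) D"
      by (rule has_sum_cmult_right)
    then have "((\<lambda>n. 4 * pi\<^sup>2 * z (e n) * (1 - cos (2 * pi * (e n \<bullet> x)))) has_sum
        2 * pi\<^sup>2 * cos_series L z x) UNIV"
      by (subst (asm) has_sum_reindex_bij_betw[OF bij, symmetric]) (simp add: mult_ac)
    then have sums: "(\<lambda>n. 4 * pi\<^sup>2 * z (e n) * (1 - cos (2 * pi * (e n \<bullet> x)))) sums
        (2 * pi\<^sup>2 * cos_series L z x)"
      by (rule has_sum_imp_sums)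
    have "(\<Sum>n. a n * f n x) = (\<Sum>n. ennreal (4 * pi\<^sup>2 * z (e n) * (1 - cos (2 * pi * (e n \<bullet> x)))))"
      using True z0[OF eD] one_minus_cos_bounds by (simp add: a_def f_def ennreal_mult)
    also have "\<dots> = ennreal (2 * pi\<^sup>2 * cos_series L z x)"
      using sums z0[OF eD] one_minus_cos_bounds
      by (intro suminf_ennreal_eq) auto
    finally show ?thesis using True by (simp add: K_def)
  qed (simp add: K_def f_def)
  have [measurable]: "K \<in> borel_measurable \<nu>"
    unfolding K_sum[abs_def] by measurable
  have [measurable]: "N \<in> borel_measurable \<nu>"
    unfolding N_def by measurable

  define q where "q n = ennreal (e n \<bullet> (Y *v e n))" for n
  define J where "J = C - trace (slack_matrix L C z ** Y)"
  have tr0: "0 \<le> trace (slack_matrix L C z ** Y)"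
    by (rule psd_trace_mult_nonneg[OF psdS psdY])
  have dval: "dual_value L \<nu> = integral\<^sup>N \<nu> N"
    unfolding dual_value_def N_def V_def[symmetric]
    by (subst nn_integral_cmult[symmetric]) (auto simp: ennreal_mult mult_ac)
  have KI: "integral\<^sup>N \<nu> K = (\<Sum>n. a n * I (e n))"
    unfolding K_sum[abs_def]
    by (subst nn_integral_suminf) (auto simp: nn_integral_cmult I_def f_def)
  have "((\<lambda>u. 4 * pi\<^sup>2 * z u * (u \<bullet> (Y *v u))) has_sum J) D"
    unfolding J_def D_def by (rule slack_trace[OF primal trY])
  then have "(\<lambda>n. 4 * pi\<^sup>2 * z (e n) * (e n \<bullet> (Y *v e n))) sums J"
    by (subst (asm) has_sum_reindex_bij_betw[OF bij, symmetric]) (rule has_sum_imp_sums)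
  then have Jq: "(\<Sum>n. a n * q n) = ennreal J"
    using z0[OF eD] Y0
    by (subst suminf_ennreal_eq[symmetric]) (auto simp: a_def q_def ennreal_mult)

  have N_le_K: "N x \<le> K x" for x
    using le_cos[of x] by (auto simp: N_def K_def intro!: ennreal_leI split: split_indicator)
  have term_le: "a n * I (e n) \<le> a n * q n" for n
    using I_le[OF eD] by (simp add: q_def mult_left_mono)
  have s1: "integral\<^sup>N \<nu> N \<le> integral\<^sup>N \<nu> K" by (intro nn_integral_mono N_le_K)
  have s2: "integral\<^sup>N \<nu> K \<le> ennreal J"
    unfolding KI Jq[symmetric] by (intro suminf_le term_le) auto
  have s3: "ennreal J \<le> ennreal C" using tr0 by (intro ennreal_leI) (simp add: J_def)
  show "dual_value L \<nu> \<le> ennreal C" unfolding dval using s1 s2 s3 by order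

  have e1: "integral\<^sup>N \<nu> N = integral\<^sup>N \<nu> K \<longleftrightarrow> ?c2"
  proof
    assume "integral\<^sup>N \<nu> N = integral\<^sup>N \<nu> K"
    moreover have "integral\<^sup>N \<nu> K < \<infinity>" 
      using s2 by (rule le_less_trans) simp
    ultimately have "AE x in \<nu>. N x = K x"
      by (intro nn_integral_eq_imp_AE_eq) (auto simp: N_le_K)
    then have "AE x in \<nu>. x \<in> V \<and> (norm x)\<^sup>2 = cos_series L z x"
      using AEV
    proof eventually_elim
      case (elim x)
      then have "ennreal (2 * pi\<^sup>2 * (norm x)\<^sup>2) = ennreal (2 * pi\<^sup>2 * cos_series L z x)"
        by (simp add: N_def K_def)
      moreover have "0 \<le> cos_series L z x"
        using le_cos[of x] elim zero_le_power2[of "norm x"] by linarith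
      ultimately show ?case using elim by simp
    qed
    then show ?c2 by (simp add: supported_on_def V_def)
  next
    assume ?c2
    then have "AE x in \<nu>. x \<in> V \<and> (norm x)\<^sup>2 = cos_series L z x"
      by (simp add: supported_on_def V_def)
    then show "integral\<^sup>N \<nu> N = integral\<^sup>N \<nu> K"
      by (intro nn_integral_cong_AE) (auto simp: N_def K_def)
  qed
  have e2: "integral\<^sup>N \<nu> K = ennreal J \<longleftrightarrow> ?c3"
  proof
    assume "integral\<^sup>N \<nu> K = ennreal J"
    then have eq: "(\<integral>\<^sup>+n. a n * I (e n) \<partial>count_space UNIV) = (\<integral>\<^sup>+n. a n * q n \<partial>count_space UNIV)"
      by (simp add: nn_integral_count_space_nat KI Jq)
    have "AE n in count_space UNIV. a n * I (e n) = a n * q n"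
      by (rule nn_integral_eq_imp_AE_eq[OF _ _ _ eq])
         (auto simp: term_le nn_integral_count_space_nat Jq)
    then have *: "a n * I (e n) = a n * q n" for n by (simp add: AE_count_space)
    show ?c3
    proof (intro ballI impI)
      fix u assume "u \<in> dual_lattice L" "z u \<noteq> 0"
      then obtain n where n: "u = e n" using bij by (auto simp: bij_betw_def D_def)
      have "0 < z (e n)" using z0[OF eD[of n]] \<open>z u \<noteq> 0\<close> n by simp
      then have "a n \<noteq> 0" "a n \<noteq> \<infinity>" by (simp_all add: a_def ennreal_eq_0_iff not_le)
      then have "I (e n) = q n" using * [of n] by (simp add: ennreal_mult_cancel_left)
      then show "(\<integral>\<^sup>+x\<in>voronoi_cell L. ennreal (1 - cos (2 * pi * (u \<bullet> x))) \<partial>\<nu>) = ennreal (u \<bullet> (Y *v u))"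
        by (simp add: n I_def q_def V_def)
    qed
  next
    assume c3: ?c3
    have "a n * I (e n) = a n * q n" for n
    proof (cases "z (e n) = 0")
      case False
      then show ?thesis using c3 eD[of n] by (simp add: I_def q_def V_def D_def)
    qed (simp add: a_def)
    then show "integral\<^sup>N \<nu> K = ennreal J" by (simp add: KI Jq[symmetric])
  qed
  have e3: "ennreal J = ennreal C \<longleftrightarrow> ?c1"
  proof -
    have "J = C" if "ennreal J = ennreal C"
    proof (cases "0 \<le> J")
      case False
      then have "C = 0" using that C0 by (simp add: ennreal_neg)
      moreover have "0 \<le> J"
        using \<open>(\<lambda>n. 4 * pi\<^sup>2 * z (e n) * (e n \<bullet> (Y *v e n))) sums J\<close>
        by (rule sums_le[OF _ sums_zero, rotated]) (use z0[OF eD] Y0 in auto)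
      ultimately show ?thesis using False by simp
    qed (use that C0 in simp)
    then have "ennreal J = ennreal C \<longleftrightarrow> J = C" by auto
    then show ?thesis
      using psd_trace_mult_eq_0_iff[OF psdS psdY] by (auto simp: J_def)
  qed
  have "ennreal C = integral\<^sup>N \<nu> N \<longleftrightarrow>
      integral\<^sup>N \<nu> N = integral\<^sup>N \<nu> K \<and> integral\<^sup>N \<nu> K = ennreal J \<and> ennreal J = ennreal C"
    using s1 s2 s3 by (metis order_antisym_conv order_trans)
  then show "ennreal C = dual_value L \<nu> \<longleftrightarrow> ?c1 \<and> ?c2 \<and> ?c3"
    unfolding dval e1 e2 e3 by blast
qed

section \<open>A copy of \<open>\<ell>\<^sup>2\<close> inside a large type\<close>

text \<open>A complex sequence is determined by the rationals below the real and imaginary parts of its terms,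
  that is, by a set of triples from a countable type.\<close>

lemma complex_sequences_lepoll_reals: "(UNIV :: (nat \<Rightarrow> complex) set) \<lesssim> (UNIV :: real set)"
proof -
  define cut :: "(nat \<Rightarrow> complex) \<Rightarrow> (nat \<times> bool \<times> rat) set"
    where "cut x = {(n, b, q). real_of_rat q < (if b then Re (x n) else Im (x n))}" for x
  have cut_real: "s = t" if "\<And>q. real_of_rat q < s \<longleftrightarrow> real_of_rat q < t" for s t
  proof (rule linorder_cases[of s t])
    assume "s < t"
    then obtain q where "s < real_of_rat q" "real_of_rat q < t" using of_rat_dense by blast
    then show ?thesis using that[of q] by simp
  next
    assume "t < s"
    then obtain q where "t < real_of_rat q" "real_of_rat q < s" using of_rat_dense by blast
    then show ?thesis using that[of q] by simp
  qed
  have "inj cut"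
  proof (rule injI, rule ext)
    fix x y n assume eq: "cut x = cut y"
    have "(n, b, q) \<in> cut x \<longleftrightarrow> (n, b, q) \<in> cut y" for b q by (simp add: eq)
    from this[of True] this[of False]
    have "real_of_rat q < Re (x n) \<longleftrightarrow> real_of_rat q < Re (y n)"
      "real_of_rat q < Im (x n) \<longleftrightarrow> real_of_rat q < Im (y n)" for q
      by (simp_all add: cut_def)
    then show "x n = y n" by (intro complex_eqI cut_real)
  qed
  moreover have "inj (image (to_nat :: nat \<times> bool \<times> rat \<Rightarrow> nat))"
    by (simp add: inj_on_def inj_image_eq_iff[OF inj_to_nat])
  ultimately have "inj (image to_nat \<circ> cut)" by (rule inj_compose[rotated])
  then have "(UNIV :: (nat \<Rightarrow> complex) set) \<lesssim> (UNIV :: nat set set)"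
    by (auto simp: lepoll_def)
  then show ?thesis
    by (rule lepoll_trans2[OF _ nat_sets_eqpoll_reals])
qed

definition ell2 :: "(nat \<Rightarrow> complex) set" where
  "ell2 = {x. summable (\<lambda>n. (cmod (x n))\<^sup>2)}"

text \<open>The least distortion is an infimum over Hilbert spaces whose elements belong to one given type, so
  \<open>\<ell>\<^sup>2\<close> is transported into that type along an injection \<open>j\<close>.\<close>

definition ell2_copy :: "((nat \<Rightarrow> complex) \<Rightarrow> 'h) \<Rightarrow> 'h cinner_space" where
  "ell2_copy j =
     \<lparr>carrier = j ` ell2, mult = (\<lambda>a b. j (\<lambda>n. 0)), one = j (\<lambda>n. 0), zero = j (\<lambda>n. 0),
      add = (\<lambda>a b. j (\<lambda>n. inv_into UNIV j a n + inv_into UNIV j b n)),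
      smult = (\<lambda>c a. j (\<lambda>n. c * inv_into UNIV j a n)),
      cinner = (\<lambda>a b. \<Sum>n. inv_into UNIV j a n * cnj (inv_into UNIV j b n))\<rparr>"

lemma ell2_inner_summable:
  assumes "x \<in> ell2" "y \<in> ell2"
  shows "summable (\<lambda>n. x n * cnj (y n))"
proof (rule summable_comparison_test')
  show "summable (\<lambda>n. (cmod (x n))\<^sup>2 + (cmod (y n))\<^sup>2)"
    using assms by (auto simp: ell2_def intro: summable_add)
  fix n
  have "0 \<le> (cmod (x n) - cmod (y n))\<^sup>2" by simp
  then have "2 * (cmod (x n) * cmod (y n)) \<le> (cmod (x n))\<^sup>2 + (cmod (y n))\<^sup>2"
    by (simp add: power2_diff)
  moreover have "0 \<le> cmod (x n) * cmod (y n)" by simp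
  ultimately show "norm (x n * cnj (y n)) \<le> (cmod (x n))\<^sup>2 + (cmod (y n))\<^sup>2"
    by (simp add: norm_mult del: mult_nonneg_nonneg)
qed

lemma ell2_add: "x \<in> ell2 \<Longrightarrow> y \<in> ell2 \<Longrightarrow> (\<lambda>n. x n + y n) \<in> ell2"
proof -
  assume xy: "x \<in> ell2" "y \<in> ell2"
  have "summable (\<lambda>n. 2 * ((cmod (x n))\<^sup>2 + (cmod (y n))\<^sup>2))"
    using xy by (auto simp: ell2_def intro!: summable_mult summable_add)
  then have "summable (\<lambda>n. (cmod (x n + y n))\<^sup>2)"
  proof (rule summable_comparison_test')
    fix n
    have "(cmod (x n + y n))\<^sup>2 \<le> (cmod (x n) + cmod (y n))\<^sup>2"
      by (intro power_mono norm_triangle_ineq) auto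
    moreover have "0 \<le> (cmod (x n) - cmod (y n))\<^sup>2" by simp
    ultimately show "norm ((cmod (x n + y n))\<^sup>2) \<le> 2 * ((cmod (x n))\<^sup>2 + (cmod (y n))\<^sup>2)"
      by (simp add: power2_diff power2_sum)
  qed
  then show ?thesis by (simp add: ell2_def)
qed

lemma ell2_scale: "x \<in> ell2 \<Longrightarrow> (\<lambda>n. c * x n) \<in> ell2"
  by (auto simp: ell2_def norm_mult power_mult_distrib intro: summable_mult)

lemma ell2_zero: "(\<lambda>n. 0) \<in> ell2"
  by (simp add: ell2_def)

lemma ell2_diff: "x \<in> ell2 \<Longrightarrow> y \<in> ell2 \<Longrightarrow> (\<lambda>n. x n - y n) \<in> ell2"
  using ell2_add[of x "\<lambda>n. (-1) * y n"] ell2_scale[of y "-1"] by simp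

text \<open>A Cauchy sequence converges in every coordinate. The Cauchy estimate holds for each partial
  sum of the norm, there the limit can be taken, and the resulting bound is uniform in the length of the partial sum.\<close>

lemma ell2_complete:
  assumes F: "\<And>k. F k \<in> ell2"
    and Cauchy: "\<And>\<epsilon>. \<epsilon> > 0 \<Longrightarrow>
      \<exists>N. \<forall>k\<ge>N. \<forall>m\<ge>N. sqrt (\<Sum>n. (cmod (F k n - F m n))\<^sup>2) < \<epsilon>"
  shows "\<exists>G\<in>ell2. (\<lambda>k. sqrt (\<Sum>n. (cmod (F k n - G n))\<^sup>2)) \<longlonglongrightarrow> 0"
proof -
  have summ: "summable (\<lambda>n. (cmod (F k n - F m n))\<^sup>2)" for k m
    using ell2_diff[OF F F] by (simp add: ell2_def)
  have part: "(\<Sum>n\<in>A. (cmod (F k n - F m n))\<^sup>2) \<le> (sqrt (\<Sum>n. (cmod (F k n - F m n))\<^sup>2))\<^sup>2"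
    if "finite A" for A k m
    using sum_le_suminf[OF summ that, of k m] by (simp add: suminf_nonneg summ)
  have "Cauchy (\<lambda>k. F k n)" for n
  proof (rule metric_CauchyI)
    fix \<epsilon> :: real assume "\<epsilon> > 0"
    from Cauchy[OF this]
    obtain N where N: "\<forall>k\<ge>N. \<forall>m\<ge>N. sqrt (\<Sum>n. (cmod (F k n - F m n))\<^sup>2) < \<epsilon>" ..
    have norm_le: "cmod (F k n - F m n) \<le> sqrt (\<Sum>n. (cmod (F k n - F m n))\<^sup>2)" for k m
    proof (rule power2_le_imp_le)
      show "(cmod (F k n - F m n))\<^sup>2 \<le> (sqrt (\<Sum>n. (cmod (F k n - F m n))\<^sup>2))\<^sup>2"
        using part[of "{n}" k m] by simp
      show "0 \<le> sqrt (\<Sum>n. (cmod (F k n - F m n))\<^sup>2)"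
        by (simp add: suminf_nonneg summ)
    qed
    have "dist (F m n) (F k n) < \<epsilon>" if "m \<ge> N" "k \<ge> N" for m k
      unfolding dist_norm using le_less_trans[OF norm_le N[rule_format, OF that]] .
    then show "\<exists>N. \<forall>m\<ge>N. \<forall>k\<ge>N. dist (F m n) (F k n) < \<epsilon>" by blast
  qed
  then have G': "(\<lambda>k. F k n) \<longlonglongrightarrow> lim (\<lambda>k. F k n)" for n
    using Cauchy_convergent_iff convergent_LIMSEQ_iff by blast
  define G where "G n = lim (\<lambda>k. F k n)" for n
  have G: "(\<lambda>k. F k n) \<longlonglongrightarrow> G n" for n using G' by (simp add: G_def)
  have lim: "summable (\<lambda>n. (cmod (F k n - G n))\<^sup>2) \<and> (\<Sum>n. (cmod (F k n - G n))\<^sup>2) \<le> \<epsilon>\<^sup>2"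
    if N: "\<forall>k\<ge>N. \<forall>m\<ge>N. sqrt (\<Sum>n. (cmod (F k n - F m n))\<^sup>2) < \<epsilon>" and k: "k \<ge> N" and "\<epsilon> > 0"
    for k N \<epsilon>
  proof -
    have fin: "(\<Sum>n<M. (cmod (F k n - G n))\<^sup>2) \<le> \<epsilon>\<^sup>2" for M
    proof (rule tendsto_upperbound)
      show "(\<lambda>m. \<Sum>n<M. (cmod (F k n - F m n))\<^sup>2) \<longlonglongrightarrow> (\<Sum>n<M. (cmod (F k n - G n))\<^sup>2)"
        by (intro tendsto_intros G)
      have "(\<Sum>n<M. (cmod (F k n - F m n))\<^sup>2) \<le> \<epsilon>\<^sup>2" if "m \<ge> N" for m
      proof -
        have "(sqrt (\<Sum>n. (cmod (F k n - F m n))\<^sup>2))\<^sup>2 \<le> \<epsilon>\<^sup>2"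
          using N k that by (intro power_mono) (auto intro: less_imp_le suminf_nonneg summ)
        then show ?thesis using part[OF finite_lessThan, of k m M] by linarith
      qed
      then show "\<forall>\<^sub>F m in sequentially. (\<Sum>n<M. (cmod (F k n - F m n))\<^sup>2) \<le> \<epsilon>\<^sup>2"
        by (auto simp: eventually_sequentially)
    qed simp
    have "summable (\<lambda>n. (cmod (F k n - G n))\<^sup>2)"
      by (rule summableI_nonneg_bounded[where x = "\<epsilon>\<^sup>2"]) (use fin in auto)
    moreover from this have "(\<Sum>n. (cmod (F k n - G n))\<^sup>2) \<le> \<epsilon>\<^sup>2"
      using fin by (rule suminf_le_const)
    ultimately show ?thesis by blast
  qed
  show ?thesis
  proof (rule bexI)
    obtain N where N: "\<forall>k\<ge>N. \<forall>m\<ge>N. sqrt (\<Sum>n. (cmod (F k n - F m n))\<^sup>2) < 1"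
      using Cauchy[of 1] by auto
    have "(\<lambda>n. F N n - G n) \<in> ell2"
      using lim[OF N order_refl] by (simp add: ell2_def)
    then show "G \<in> ell2" using ell2_diff[OF F[of N], of "\<lambda>n. F N n - G n"] by simp
    show "(\<lambda>k. sqrt (\<Sum>n. (cmod (F k n - G n))\<^sup>2)) \<longlonglongrightarrow> 0"
    proof (rule LIMSEQ_I)
      fix r :: real assume "r > 0"
      then obtain N where N: "\<forall>k\<ge>N. \<forall>m\<ge>N. sqrt (\<Sum>n. (cmod (F k n - F m n))\<^sup>2) < r / 2"
        using Cauchy[of "r / 2"] by auto
      have "norm (sqrt (\<Sum>n. (cmod (F k n - G n))\<^sup>2) - 0) < r" if "k \<ge> N" for k
      proof -
        have *: "(\<Sum>n. (cmod (F k n - G n))\<^sup>2) \<le> (r/2)\<^sup>2" "summable (\<lambda>n. (cmod (F k n - G n))\<^sup>2)"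
          using lim[OF N that] \<open>r > 0\<close> by auto
        have "sqrt (\<Sum>n. (cmod (F k n - G n))\<^sup>2) \<le> r / 2"
          using * \<open>r > 0\<close> by (intro real_le_lsqrt) (auto intro: suminf_nonneg)
        then show ?thesis using \<open>r > 0\<close> * by (simp add: suminf_nonneg)
      qed
      then show "\<exists>N. \<forall>k\<ge>N. norm (sqrt (\<Sum>n. (cmod (F k n - G n))\<^sup>2) - 0) < r" by blast
    qed
  qed
qed

context
  fixes j :: "(nat \<Rightarrow> complex) \<Rightarrow> 'h"
  assumes inj_j: "inj j"
begin

lemma ell2_copy_simps [simp]:
  "carrier (ell2_copy j) = j ` ell2"
  "\<zero>\<^bsub>ell2_copy j\<^esub> = j (\<lambda>n. 0)"
  "j x \<oplus>\<^bsub>ell2_copy j\<^esub> j y = j (\<lambda>n. x n + y n)"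
  "c \<odot>\<^bsub>ell2_copy j\<^esub> j x = j (\<lambda>n. c * x n)"
  "cinner (ell2_copy j) (j x) (j y) = (\<Sum>n. x n * cnj (y n))"
  by (simp_all add: ell2_copy_def inv_f_f[OF inj_j])

lemma abelian_group_ell2_copy: "abelian_group (ell2_copy j)"
proof (rule abelian_groupI)
  fix x assume "x \<in> carrier (ell2_copy j)"
  then obtain x' where x': "x' \<in> ell2" "x = j x'" by auto
  have "(\<lambda>n. - x' n) \<in> ell2" using ell2_scale[OF x'(1), of "-1"] by simp
  then show "\<exists>y\<in>carrier (ell2_copy j). y \<oplus>\<^bsub>ell2_copy j\<^esub> x = \<zero>\<^bsub>ell2_copy j\<^esub>"
    using x' by (intro bexI[of _ "j (\<lambda>n. - x' n)"]) auto
qed (auto simp: ell2_zero ell2_add add_ac intro!: imageI)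

lemma ell2_copy_minus:
  assumes "x \<in> ell2" "y \<in> ell2"
  shows "j x \<ominus>\<^bsub>ell2_copy j\<^esub> j y = j (\<lambda>n. x n - y n)"
proof -
  interpret abelian_group "ell2_copy j" by (rule abelian_group_ell2_copy)
  have "(\<lambda>n. - y n) \<in> ell2" using ell2_scale[OF assms(2), of "-1"] by simp
  then have "\<ominus>\<^bsub>ell2_copy j\<^esub> j y = j (\<lambda>n. - y n)"
    using assms by (intro minus_equality) auto
  then show ?thesis by (simp add: a_minus_def)
qed

lemma ell2_copy_cinner_self:
  assumes "x \<in> ell2"
  shows "cinner (ell2_copy j) (j x) (j x) = complex_of_real (\<Sum>n. (cmod (x n))\<^sup>2)"
proof -
  have "(\<Sum>n. complex_of_real ((cmod (x n))\<^sup>2)) = complex_of_real (\<Sum>n. (cmod (x n))\<^sup>2)"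
    using assms by (intro suminf_of_real[symmetric]) (simp add: ell2_def)
  then show ?thesis by (simp add: complex_norm_square[symmetric] del: of_real_power)
qed

lemma ell2_copy_cnorm:
  assumes "x \<in> ell2"
  shows "cnorm (ell2_copy j) (j x) = sqrt (\<Sum>n. (cmod (x n))\<^sup>2)"
  by (simp add: cnorm_def ell2_copy_cinner_self[OF assms] del: ell2_copy_simps)

lemma complex_hilbert_space_ell2_copy: "complex_hilbert_space (ell2_copy j)"
proof (rule complex_hilbert_space.intro)
  show "module (cring_class_ops :: complex ring) (ell2_copy j)"
    by (rule moduleI[OF cring_class abelian_group_ell2_copy])
       (auto simp: ell2_scale ell2_add algebra_simps carrier_class plus_class times_class one_class intro!: imageI)
  show "complex_hilbert_space_axioms (ell2_copy j)"
  proof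
    fix x y w assume "x \<in> carrier (ell2_copy j)" "y \<in> carrier (ell2_copy j)" "w \<in> carrier (ell2_copy j)"
    then show "cinner (ell2_copy j) (x \<oplus>\<^bsub>ell2_copy j\<^esub> y) w =
        cinner (ell2_copy j) x w + cinner (ell2_copy j) y w"
      by (auto simp: distrib_right suminf_add ell2_inner_summable)
  next
    fix x w a assume "x \<in> carrier (ell2_copy j)" "w \<in> carrier (ell2_copy j)"
    then show "cinner (ell2_copy j) (a \<odot>\<^bsub>ell2_copy j\<^esub> x) w = a * cinner (ell2_copy j) x w"
      by (auto simp: mult.assoc suminf_mult ell2_inner_summable)
  next
    fix x y assume "x \<in> carrier (ell2_copy j)" "y \<in> carrier (ell2_copy j)"
    then obtain x' y' where *: "x' \<in> ell2" "x = j x'" "y' \<in> ell2" "y = j y'" by auto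
    then have "(\<lambda>n. y' n * cnj (x' n)) sums (\<Sum>n. y' n * cnj (x' n))"
      by (intro summable_sums ell2_inner_summable)
    then have "(\<lambda>n. cnj (y' n * cnj (x' n))) sums cnj (\<Sum>n. y' n * cnj (x' n))"
      by (simp only: sums_cnj)
    then have "(\<Sum>n. cnj (y' n * cnj (x' n))) = cnj (\<Sum>n. y' n * cnj (x' n))"
      by (rule sums_unique[symmetric])
    then show "cinner (ell2_copy j) x y = cnj (cinner (ell2_copy j) y x)"
      by (simp add: * mult.commute)
  next
    fix x assume "x \<in> carrier (ell2_copy j)"
    then obtain x' where x': "x' \<in> ell2" "x = j x'" by auto
    then have summ: "summable (\<lambda>n. (cmod (x' n))\<^sup>2)" by (simp add: ell2_def)
    then show "0 \<le> Re (cinner (ell2_copy j) x x)"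
      by (simp add: x' ell2_copy_cinner_self suminf_nonneg del: ell2_copy_simps)
    assume "cinner (ell2_copy j) x x = 0"
    then have "(\<Sum>n. (cmod (x' n))\<^sup>2) = 0"
      using x' by (simp add: ell2_copy_cinner_self del: ell2_copy_simps)
    then have "x' = (\<lambda>n. 0)" using suminf_eq_zero_iff[OF summ] by auto
    then show "x = \<zero>\<^bsub>ell2_copy j\<^esub>" by (simp add: x')
  next
    fix f :: "nat \<Rightarrow> 'h"
    assume "\<forall>k. f k \<in> carrier (ell2_copy j)"
      and C: "\<forall>\<epsilon>>0. \<exists>N. \<forall>k\<ge>N. \<forall>m\<ge>N. cnorm (ell2_copy j) (f k \<ominus>\<^bsub>ell2_copy j\<^esub> f m) < \<epsilon>"
    then have "\<forall>k. \<exists>x. x \<in> ell2 \<and> f k = j x" by auto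
    then obtain F where F: "\<And>k. F k \<in> ell2" "\<And>k. f k = j (F k)" by metis
    have "\<exists>G\<in>ell2. (\<lambda>k. sqrt (\<Sum>n. (cmod (F k n - G n))\<^sup>2)) \<longlonglongrightarrow> 0"
      using C by (intro ell2_complete F(1)) (simp add: F ell2_copy_minus ell2_copy_cnorm ell2_diff)
    then obtain G where "G \<in> ell2" "(\<lambda>k. sqrt (\<Sum>n. (cmod (F k n - G n))\<^sup>2)) \<longlonglongrightarrow> 0" by blast
    then show "\<exists>x\<in>carrier (ell2_copy j). (\<lambda>k. cnorm (ell2_copy j) (f k \<ominus>\<^bsub>ell2_copy j\<^esub> x)) \<longlonglongrightarrow> 0"
      by (intro bexI[of _ "j G"]) (simp_all add: F ell2_copy_minus ell2_copy_cnorm ell2_diff)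
  qed
qed

end

section \<open>The embedding given by a primal feasible point\<close>

lemma torus_representative:
  assumes "is_lattice L" "X \<in> torus L"
  shows "X = torus_rel L `` {SOME x. x \<in> X}"
proof -
  have eq: "equiv UNIV (torus_rel L)" by (rule equiv_torus_rel[OF assms(1)])
  obtain x where x: "X = torus_rel L `` {x}"
    using assms(2) unfolding torus_def by (rule quotientE)
  have "(SOME x. x \<in> X) \<in> X"
    by (rule someI[of _ x]) (simp add: x torus_rel_def lattice_zero[OF assms(1)])
  then have "(x, SOME x. x \<in> X) \<in> torus_rel L" unfolding x by simp
  then show ?thesis using equiv_class_eq[OF eq] x by metis
qed

lemma torus_classes_eq_iff:
  assumes "is_lattice L"
  shows "torus_rel L `` {x} = torus_rel L `` {y} \<longleftrightarrow> x - y \<in> L"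
  using equiv_class_eq_iff[OF equiv_torus_rel[OF assms], of x y] by (simp add: torus_rel_def)

lemma torus_dist_voronoi:
  assumes "is_lattice L" "X \<in> torus L" "Y \<in> torus L"
  obtains v where "v \<in> L" "(SOME x. x \<in> X) - (SOME y. y \<in> Y) - v \<in> voronoi_cell L"
    "torus_dist L X Y = norm ((SOME x. x \<in> X) - (SOME y. y \<in> Y) - v)"
  using voronoi_translate[OF assms(1), of "(SOME x. x \<in> X) - (SOME y. y \<in> Y)"]
  unfolding torus_dist_def by metis

lemma cos_series_periodic:
  assumes "v \<in> L"
  shows "cos_series L z (x - v) = cos_series L z x"
proof -
  have "cos (2 * pi * (u \<bullet> (x - v))) = cos (2 * pi * (u \<bullet> x))" if "u \<in> dual_lattice L" for u
  proof -
    have "u \<bullet> v \<in> \<int>" using that assms by (auto simp: dual_lattice_def)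
    then have "cos (2 * pi * (u \<bullet> v)) = 1" "sin (2 * pi * (u \<bullet> v)) = 0"
      by (simp_all add: cos_integer_2pi sin_integer_2pi)
    then show ?thesis by (simp add: inner_diff_right right_diff_distrib cos_diff)
  qed
  then show ?thesis by (simp add: cos_series_def cong: infsum_cong)
qed

lemma cos_series_le_quadratic:
  assumes "primal_feasible L C z"
  shows "cos_series L z x \<le> C * (norm x)\<^sup>2"
proof -
  have z: "\<And>u. u \<in> dual_lattice L \<Longrightarrow> 0 \<le> z u" "(\<lambda>u. \<bar>z u\<bar>) summable_on dual_lattice L"
    "(\<lambda>u. z u *\<^sub>R outer u) summable_on dual_lattice L"
    and psd: "psd (slack_matrix L C z)"
    using assms by (auto simp: primal_feasible_def)
  have "cos_series L z x \<le> C * (norm x)\<^sup>2 - x \<bullet> (slack_matrix L C z *v x)"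
  proof (rule has_sum_mono)
    show "((\<lambda>u. 2 * (z u * (1 - cos (2 * pi * (u \<bullet> x))))) has_sum cos_series L z x) (dual_lattice L)"
      by (rule cos_series_has_sum[OF z(2,1)])
    show "((\<lambda>u. 4 * pi\<^sup>2 * z u * (u \<bullet> x)\<^sup>2) has_sum (C * (norm x)\<^sup>2 - x \<bullet> (slack_matrix L C z *v x)))
        (dual_lattice L)"
      by (rule slack_quadratic[OF z(3)])
    fix u assume "u \<in> dual_lattice L"
    then have "2 * (z u * (1 - cos (2 * pi * (u \<bullet> x)))) \<le> 2 * (z u * ((2 * pi * (u \<bullet> x))\<^sup>2 / 2))"
      by (intro mult_left_mono one_minus_cos_bounds z) auto
    then show "2 * (z u * (1 - cos (2 * pi * (u \<bullet> x)))) \<le> 4 * pi\<^sup>2 * z u * (u \<bullet> x)\<^sup>2"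
      by (simp add: power_mult_distrib mult_ac)
  qed
  then show ?thesis using psd by (simp add: psd_def) (smt (verit))
qed

lemma cmod_cis_diff_squared: "(cmod (cis a - cis b))\<^sup>2 = 2 * (1 - cos (a - b))"
proof -
  have "(cmod (cis a - cis b))\<^sup>2 = (cos a - cos b)\<^sup>2 + (sin a - sin b)\<^sup>2"
    by (simp add: cmod_power2)
  also have "\<dots> = ((sin a)\<^sup>2 + (cos a)\<^sup>2) + ((sin b)\<^sup>2 + (cos b)\<^sup>2) - 2 * (cos a * cos b + sin a * sin b)"
    by (simp only: power2_diff algebra_simps)
  finally show ?thesis by (simp add: cos_diff)
qed

text \<open>The coordinates of the embedding are the characters of the torus, the one at \<open>u\<close> weighted by \<open>sqrt (z u)\<close>. It
  is evaluated at the same representatives of the classes as the torus distance. Injectivity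
  follows from the lower bound by the torus distance.\<close>

proposition least_distortion_le_primal:
  fixes L :: "(real^'n) set"
  assumes L: "is_lattice L" and primal: "primal_feasible L C z"
    and card: "(UNIV :: real set) \<lesssim> (UNIV :: 'h set)"
  shows "(least_distortion TYPE('h) L)\<^sup>2 \<le> ennreal C"
proof -
  define D where "D = dual_lattice L"
  have C0: "0 \<le> C" and z0: "\<And>u. u \<in> D \<Longrightarrow> 0 \<le> z u" and abs: "(\<lambda>u. \<bar>z u\<bar>) summable_on D"
    and le_cos: "\<And>x. x \<in> voronoi_cell L \<Longrightarrow> (norm x)\<^sup>2 \<le> cos_series L z x"
    using primal by (auto simp: primal_feasible_def D_def)
  have "(UNIV :: (nat \<Rightarrow> complex) set) \<lesssim> (UNIV :: 'h set)"
    using lepoll_trans[OF complex_sequences_lepoll_reals card] .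
  then obtain j :: "(nat \<Rightarrow> complex) \<Rightarrow> 'h" where j: "inj j" by (auto simp: lepoll_def)
  define H where "H = ell2_copy j"
  define e where "e = from_nat_into D"
  have bij: "bij_betw e UNIV D"
    unfolding e_def D_def
    by (intro bij_betw_from_nat_into dual_lattice_countable_infinite[OF L])
  have eD: "e n \<in> D" for n using bij by (auto simp: bij_betw_def)
  define \<psi> where "\<psi> x n = complex_of_real (sqrt (z (e n))) * cis (2 * pi * (e n \<bullet> x))" for x n
  define rep :: "(real^'n) set \<Rightarrow> real^'n" where "rep X = (SOME x. x \<in> X)" for X
  define \<phi> where "\<phi> X = j (\<psi> (rep X))" for X

  have diff_sum: "(\<lambda>n. (cmod (\<psi> x n - \<psi> y n))\<^sup>2) sums cos_series L z (x - y)" for x y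
  proof -
    have "((\<lambda>u. 2 * (z u * (1 - cos (2 * pi * (u \<bullet> (x - y)))))) has_sum cos_series L z (x - y)) D"
      unfolding D_def by (rule cos_series_has_sum) (use z0 abs in \<open>auto simp: D_def\<close>)
    then have "(\<lambda>n. 2 * (z (e n) * (1 - cos (2 * pi * (e n \<bullet> (x - y)))))) sums cos_series L z (x - y)"
      by (subst (asm) has_sum_reindex_bij_betw[OF bij, symmetric]) (rule has_sum_imp_sums)
    moreover have "(cmod (\<psi> x n - \<psi> y n))\<^sup>2 = 2 * (z (e n) * (1 - cos (2 * pi * (e n \<bullet> (x - y)))))" for n
    proof -
      have "\<psi> x n - \<psi> y n = sqrt (z (e n)) * (cis (2 * pi * (e n \<bullet> x)) - cis (2 * pi * (e n \<bullet> y)))"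
        by (simp add: \<psi>_def algebra_simps)
      then have "(cmod (\<psi> x n - \<psi> y n))\<^sup>2 =
          (sqrt (z (e n)))\<^sup>2 * (cmod (cis (2 * pi * (e n \<bullet> x)) - cis (2 * pi * (e n \<bullet> y))))\<^sup>2"
        by (simp add: norm_mult power_mult_distrib)
      also have "\<dots> = z (e n) * (2 * (1 - cos (2 * pi * (e n \<bullet> x) - 2 * pi * (e n \<bullet> y))))"
        using z0[OF eD] by (simp add: cmod_cis_diff_squared)
      finally show ?thesis by (simp add: inner_diff_right right_diff_distrib)
    qed
    ultimately show ?thesis by simp
  qed
  have \<psi>: "\<psi> x \<in> ell2" for x
  proof -
    have "(\<lambda>n. \<bar>z (e n)\<bar>) summable_on UNIV"
      using abs by (subst summable_on_reindex_bij_betw[OF bij])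
    then have "summable (\<lambda>n. \<bar>z (e n)\<bar>)" by (rule summable_on_imp_summable)
    then show ?thesis using z0[OF eD] by (simp add: ell2_def \<psi>_def norm_mult)
  qed
  have cn: "(cnorm H (\<phi> X \<ominus>\<^bsub>H\<^esub> \<phi> Y))\<^sup>2 = cos_series L z (rep X - rep Y)"
    and cn0: "0 \<le> cnorm H (\<phi> X \<ominus>\<^bsub>H\<^esub> \<phi> Y)" for X Y
  proof -
    have "cnorm H (\<phi> X \<ominus>\<^bsub>H\<^esub> \<phi> Y) = sqrt (cos_series L z (rep X - rep Y))"
      unfolding H_def \<phi>_def
      by (simp add: ell2_copy_minus[OF j] ell2_copy_cnorm[OF j] ell2_diff \<psi> sums_unique[OF diff_sum, symmetric])
    moreover have "0 \<le> cos_series L z (rep X - rep Y)"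
      using sums_le[OF _ sums_zero diff_sum] by simp
    ultimately show "(cnorm H (\<phi> X \<ominus>\<^bsub>H\<^esub> \<phi> Y))\<^sup>2 = cos_series L z (rep X - rep Y)"
      "0 \<le> cnorm H (\<phi> X \<ominus>\<^bsub>H\<^esub> \<phi> Y)" by simp_all
  qed
  have key: "0 < torus_dist L X Y \<and> torus_dist L X Y \<le> cnorm H (\<phi> X \<ominus>\<^bsub>H\<^esub> \<phi> Y)
      \<and> cnorm H (\<phi> X \<ominus>\<^bsub>H\<^esub> \<phi> Y) \<le> sqrt C * torus_dist L X Y"
    if X: "X \<in> torus L" and Y: "Y \<in> torus L" and "X \<noteq> Y" for X Y
  proof -
    obtain v where v: "v \<in> L" "rep X - rep Y - v \<in> voronoi_cell L"
      "torus_dist L X Y = norm (rep X - rep Y - v)"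
      using torus_dist_voronoi[OF L X Y] unfolding rep_def by blast
    have "rep X - rep Y \<noteq> v"
      using \<open>X \<noteq> Y\<close> v(1) torus_representative[OF L X] torus_representative[OF L Y]
        torus_classes_eq_iff[OF L, of "rep X" "rep Y"] unfolding rep_def by metis
    moreover have "(torus_dist L X Y)\<^sup>2 \<le> (cnorm H (\<phi> X \<ominus>\<^bsub>H\<^esub> \<phi> Y))\<^sup>2"
      using le_cos[OF v(2)] by (simp add: cn v(3) cos_series_periodic[OF v(1)])
    moreover have "(cnorm H (\<phi> X \<ominus>\<^bsub>H\<^esub> \<phi> Y))\<^sup>2 \<le> (sqrt C * torus_dist L X Y)\<^sup>2"
      using cos_series_le_quadratic[OF primal, of "rep X - rep Y - v"] C0
      by (simp add: cn v(3) cos_series_periodic[OF v(1)] power_mult_distrib)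
    ultimately show ?thesis
      using cn0 C0 v(3) by (auto intro: power2_le_imp_le)
  qed
  have emb: "euclidean_embedding L H \<phi>"
    unfolding euclidean_embedding_def
  proof (intro conjI)
    show hs: "complex_hilbert_space H"
      unfolding H_def by (rule complex_hilbert_space_ell2_copy[OF j])
    show "\<phi> \<in> torus L \<rightarrow> carrier H"
      by (simp add: \<phi>_def H_def ell2_copy_simps[OF j] \<psi>)
    show "inj_on \<phi> (torus L)"
    proof (rule inj_onI, rule ccontr)
      fix X Y assume *: "X \<in> torus L" "Y \<in> torus L" "\<phi> X = \<phi> Y" "X \<noteq> Y"
      have "cnorm H (\<phi> Y \<ominus>\<^bsub>H\<^esub> \<phi> Y) = 0"
        unfolding H_def \<phi>_def
        by (simp add: ell2_copy_minus[OF j] ell2_copy_cnorm[OF j] ell2_zero \<psi>)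
      then show False using key[OF *(1,2,4)] *(3) by auto
    qed
  qed
  have "distortion L H \<phi> \<le> ennreal (sqrt C) * ennreal 1"
    unfolding distortion_def
  proof (intro mult_mono)
    show "(SUP (X, Y) \<in> {(X, Y). X \<in> torus L \<and> Y \<in> torus L \<and> X \<noteq> Y}.
        ennreal (cnorm H (\<phi> X \<ominus>\<^bsub>H\<^esub> \<phi> Y) / torus_dist L X Y)) \<le> ennreal (sqrt C)"
    proof (intro SUP_least, clarify)
      fix X Y assume "X \<in> torus L" "Y \<in> torus L" "X \<noteq> Y"
      from key[OF this] show "ennreal (cnorm H (\<phi> X \<ominus>\<^bsub>H\<^esub> \<phi> Y) / torus_dist L X Y) \<le> ennreal (sqrt C)"
        by (intro ennreal_leI) (simp add: divide_le_eq)
    qed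
    show "(SUP (X, Y) \<in> {(X, Y). X \<in> torus L \<and> Y \<in> torus L \<and> X \<noteq> Y}.
        ennreal (torus_dist L X Y / cnorm H (\<phi> X \<ominus>\<^bsub>H\<^esub> \<phi> Y))) \<le> ennreal 1"
    proof (intro SUP_least, clarify)
      fix X Y assume "X \<in> torus L" "Y \<in> torus L" "X \<noteq> Y"
      from key[OF this] show "ennreal (torus_dist L X Y / cnorm H (\<phi> X \<ominus>\<^bsub>H\<^esub> \<phi> Y)) \<le> ennreal 1"
        by (intro ennreal_leI) (simp add: divide_le_eq)
    qed
  qed auto
  moreover have "least_distortion TYPE('h) L \<le> distortion L H \<phi>"
    unfolding least_distortion_def using emb by (intro Inf_lower) blast
  ultimately have "least_distortion TYPE('h) L \<le> ennreal (sqrt C)" by simp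
  then have "(least_distortion TYPE('h) L)\<^sup>2 \<le> (ennreal (sqrt C))\<^sup>2"
    by (intro power_mono) auto
  also have "\<dots> = ennreal C" using C0 by (simp add: ennreal_power)
  finally show ?thesis .
qed

section \<open>Fourier inversion on a finite grid\<close>

definition ivec :: "('n \<Rightarrow> int) \<Rightarrow> real^'n" where
  "ivec p = (\<chi> i. real_of_int (p i))"

text \<open>With \<open>M = 2 r + 1\<close>, this box represents \<open>(\<int>/M)\<^sup>n\<close>. It is used for the grid points and for the
  frequencies alike. It has to be centred for the sake of the frequencies: \<open>2 \<pi> u\<^sub>i / M\<close> then stays in
  \<open>[-\<pi>, \<pi>]\<close>, where \<open>1 - cos\<close> is comparable to the square.\<close>

definition box_grid :: "nat \<Rightarrow> ('n \<Rightarrow> int) set" where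
  "box_grid r = PiE UNIV (\<lambda>_. {- int r..int r})"

lemma mem_box_grid: "p \<in> box_grid r \<longleftrightarrow> (\<forall>i. - int r \<le> p i \<and> p i \<le> int r)"
  by (auto simp: box_grid_def PiE_iff)

lemma finite_box_grid [simp]: "finite (box_grid r :: ('n::finite \<Rightarrow> int) set)"
  by (simp add: box_grid_def finite_PiE)

lemma card_box_grid: "card (box_grid r :: ('n::finite \<Rightarrow> int) set) = (2 * r + 1) ^ CARD('n)"
  by (simp add: box_grid_def card_PiE nat_add_distrib nat_mult_distrib)

definition grid_reduce :: "nat \<Rightarrow> ('n \<Rightarrow> int) \<Rightarrow> 'n \<Rightarrow> int" where
  "grid_reduce r p i = (p i + int r) mod (2 * int r + 1) - int r"

lemma grid_reduce_in_box: "grid_reduce r p \<in> box_grid r"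
proof -
  have "0 \<le> (p i + int r) mod (2 * int r + 1)" "(p i + int r) mod (2 * int r + 1) < 2 * int r + 1" for i
    by (rule pos_mod_sign pos_mod_bound; simp)+
  then show ?thesis
    unfolding mem_box_grid grid_reduce_def by (smt (verit))
qed

lemma grid_reduce_eq: "grid_reduce r p = (\<lambda>i. p i + (2 * int r + 1) * (- ((p i + int r) div (2 * int r + 1))))"
  unfolding grid_reduce_def by (rule ext) (simp add: minus_div_mult_eq_mod[symmetric] algebra_simps)

lemma dvd_grid_reduce: "2 * int r + 1 dvd p i - grid_reduce r p i"
  unfolding grid_reduce_eq by simp

lemma box_grid_eqI:
  assumes "g \<in> box_grid r" "h \<in> box_grid r" "\<And>i. 2 * int r + 1 dvd g i - h i"
  shows "g = h"
proof
  fix i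
  have "\<bar>g i - h i\<bar> < 2 * int r + 1"
    using assms(1,2) unfolding mem_box_grid by (smt (verit))
  then show "g i = h i"
    using dvd_imp_le_int[OF _ assms(3)[of i]] by fastforce
qed

lemma sum_box_grid_shift:
  fixes F :: "('n::finite \<Rightarrow> int) \<Rightarrow> 'b::comm_monoid_add"
  assumes per: "\<And>p s. F (\<lambda>i. p i + (2 * int r + 1) * s i) = F p"
  shows "(\<Sum>g\<in>box_grid r. F (\<lambda>i. g i + q i)) = (\<Sum>g\<in>box_grid r. F g)"
proof (rule sum.reindex_bij_witness[of _ "\<lambda>g. grid_reduce r (\<lambda>i. g i - q i)"
      "\<lambda>g. grid_reduce r (\<lambda>i. g i + q i)"])
  fix g :: "'n \<Rightarrow> int" assume g: "g \<in> box_grid r"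
  show "grid_reduce r (\<lambda>i. grid_reduce r (\<lambda>i. g i + q i) i - q i) = g"
  proof (rule box_grid_eqI[OF grid_reduce_in_box g])
    fix i
    have "2 * int r + 1 dvd (g i + q i) - grid_reduce r (\<lambda>i. g i + q i) i"
      "2 * int r + 1 dvd (grid_reduce r (\<lambda>i. g i + q i) i - q i)
        - grid_reduce r (\<lambda>i. grid_reduce r (\<lambda>i. g i + q i) i - q i) i"
      by (rule dvd_grid_reduce)+
    then have "2 * int r + 1 dvd ((g i + q i) - grid_reduce r (\<lambda>i. g i + q i) i) +
        ((grid_reduce r (\<lambda>i. g i + q i) i - q i)
        - grid_reduce r (\<lambda>i. grid_reduce r (\<lambda>i. g i + q i) i - q i) i)"
      by (rule dvd_add)
    then show "2 * int r + 1 dvd grid_reduce r (\<lambda>i. grid_reduce r (\<lambda>i. g i + q i) i - q i) i - g i"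
      by (subst dvd_minus_iff[symmetric]) (simp add: algebra_simps)
  qed
  show "grid_reduce r (\<lambda>i. g i + q i) \<in> box_grid r" by (rule grid_reduce_in_box)
  show "F (grid_reduce r (\<lambda>i. g i + q i)) = F (\<lambda>i. g i + q i)"
    unfolding grid_reduce_eq by (rule per)
next
  fix g :: "'n \<Rightarrow> int" assume g: "g \<in> box_grid r"
  show "grid_reduce r (\<lambda>i. g i - q i) \<in> box_grid r" by (rule grid_reduce_in_box)
  show "grid_reduce r (\<lambda>i. grid_reduce r (\<lambda>i. g i - q i) i + q i) = g"
  proof (rule box_grid_eqI[OF grid_reduce_in_box g])
    fix i
    have "2 * int r + 1 dvd (g i - q i) - grid_reduce r (\<lambda>i. g i - q i) i"
      "2 * int r + 1 dvd (grid_reduce r (\<lambda>i. g i - q i) i + q i)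
        - grid_reduce r (\<lambda>i. grid_reduce r (\<lambda>i. g i - q i) i + q i) i"
      by (rule dvd_grid_reduce)+
    then have "2 * int r + 1 dvd ((g i - q i) - grid_reduce r (\<lambda>i. g i - q i) i) +
        ((grid_reduce r (\<lambda>i. g i - q i) i + q i)
        - grid_reduce r (\<lambda>i. grid_reduce r (\<lambda>i. g i - q i) i + q i) i)"
      by (rule dvd_add)
    then show "2 * int r + 1 dvd grid_reduce r (\<lambda>i. grid_reduce r (\<lambda>i. g i - q i) i + q i) i - g i"
      by (subst dvd_minus_iff[symmetric]) (simp add: algebra_simps)
  qed
qed

definition phase :: "nat \<Rightarrow> ('n::finite \<Rightarrow> int) \<Rightarrow> ('n \<Rightarrow> int) \<Rightarrow> real" where
  "phase r u p = 2 * pi * (ivec u \<bullet> ivec p) / real (2 * r + 1)"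

lemma phase_int: "phase r u p = 2 * pi * real_of_int (\<Sum>i\<in>UNIV. u i * p i) / real (2 * r + 1)"
  by (simp add: phase_def ivec_def inner_vec_def)

lemma phase_commute: "phase r u p = phase r p u"
  by (simp add: phase_def inner_commute)

lemma phase_add: "phase r u (\<lambda>i. p i + q i) = phase r u p + phase r u q"
  by (simp add: phase_int distrib_left sum.distrib add_divide_distrib)

lemma phase_diff: "phase r u (\<lambda>i. p i - q i) = phase r u p - phase r u q"
  by (simp add: phase_int right_diff_distrib sum_subtractf diff_divide_distrib)

lemma cis_phase_dvd:
  assumes "\<And>i. 2 * int r + 1 dvd d i"
  shows "cis (phase r u d) = 1"
proof -
  define s where "s i = d i div (2 * int r + 1)" for i
  have s: "d i = (2 * int r + 1) * s i" for i
    using assms[of i] by (simp add: s_def)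
  have "(\<Sum>i\<in>UNIV. u i * d i) = (2 * int r + 1) * (\<Sum>i\<in>UNIV. u i * s i)"
    by (simp add: s sum_distrib_left mult_ac)
  then have "phase r u d = 2 * pi * real_of_int (\<Sum>i\<in>UNIV. u i * s i)"
    by (simp add: phase_int del: of_int_sum) (simp add: field_simps)
  then show ?thesis by (simp only: cis_multiple_2pi Ints_of_int)
qed

text \<open>If some \<open>d\<^sub>j\<close> is not divisible by \<open>M\<close>, shifting the frequencies by the \<open>j\<close>-th unit vector
  multiplies the sum of the characters by a factor different from 1, but only permutes its terms.\<close>

lemma character_sum:
  fixes d :: "'n::finite \<Rightarrow> int"
  shows "(\<Sum>u\<in>box_grid r. cos (phase r u d)) =
    (if \<forall>i. 2 * int r + 1 dvd d i then real (2 * r + 1) ^ CARD('n) else 0)"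
proof (cases "\<forall>i. 2 * int r + 1 dvd d i")
  case True
  then have "cos (phase r u d) = 1" for u
    using arg_cong[OF cis_phase_dvd[of r d u], of Re] by simp
  with True show ?thesis by (simp add: card_box_grid)
next
  case False
  then obtain j where j: "\<not> 2 * int r + 1 dvd d j" by blast
  define \<delta> :: "'n \<Rightarrow> int" where "\<delta> i = (if i = j then 1 else 0)" for i
  define S where "S = (\<Sum>u\<in>box_grid r. cis (phase r u d))"
  have "S = (\<Sum>u\<in>box_grid r. cis (phase r (\<lambda>i. u i + \<delta> i) d))"
    unfolding S_def
  proof (rule sum_box_grid_shift[symmetric])
    fix p s :: "'n \<Rightarrow> int"
    have "cis (phase r d (\<lambda>i. (2 * int r + 1) * s i)) = 1"
      by (rule cis_phase_dvd) simp
    then show "cis (phase r (\<lambda>i. p i + (2 * int r + 1) * s i) d) = cis (phase r p d)"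
      by (simp add: phase_commute[of r _ d] phase_add cis_mult[symmetric])
  qed
  also have "\<dots> = cis (phase r \<delta> d) * S"
    by (simp add: S_def sum_distrib_left phase_commute[of r _ d] phase_add cis_mult[symmetric] mult.commute)
  finally have "(1 - cis (phase r \<delta> d)) * S = 0" by (simp add: algebra_simps)
  moreover have "cis (phase r \<delta> d) \<noteq> 1"
  proof
    assume "cis (phase r \<delta> d) = 1"
    from arg_cong[OF this, of Re] have "cos (phase r \<delta> d) = 1" by simp
    then obtain m :: int where "phase r \<delta> d = of_int m * 2 * pi"
      by (auto simp: cos_one_2pi_int)
    moreover have "phase r \<delta> d = 2 * pi * real_of_int (d j) / real (2 * r + 1)"
      by (simp add: phase_int \<delta>_def if_distrib[of "\<lambda>x. x * _"] cong: if_cong)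
    ultimately have "2 * pi * real_of_int (d j) = 2 * pi * (real_of_int m * real (2 * r + 1))"
      by (simp add: divide_eq_eq mult_ac)
    then have "real_of_int (d j) = real_of_int m * real (2 * r + 1)"
      by (subst (asm) mult_left_cancel) auto
    then have "real_of_int (d j) = real_of_int (m * (2 * int r + 1))" by simp
    then have "d j = m * (2 * int r + 1)" by (simp only: of_int_eq_iff)
    with j show False by simp
  qed
  ultimately have "S = 0" by simp
  then have "Re S = 0" by simp
  with False show ?thesis by (simp add: S_def)
qed

text \<open>The squared norm of the discrete Fourier coefficient at \<open>u\<close> of a map from the grid into a Hilbert space,
  written in terms of the real part \<open>k\<close> of its Gram kernel.\<close>

definition grid_coeff :: "nat \<Rightarrow> (('n::finite \<Rightarrow> int) \<Rightarrow> ('n \<Rightarrow> int) \<Rightarrow> real) \<Rightarrow> ('n \<Rightarrow> int) \<Rightarrow> real" where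
  "grid_coeff r k u = (\<Sum>g\<in>box_grid r. \<Sum>h\<in>box_grid r. cos (phase r u (\<lambda>i. g i - h i)) * k g h) /
     (real (2 * r + 1) ^ CARD('n))\<^sup>2"

lemma grid_coeff_minus: "grid_coeff r k (\<lambda>i. - u i) = grid_coeff r k u"
proof -
  have "phase r (\<lambda>i. - u i) p = - phase r u p" for p
    by (simp add: phase_int sum_negf)
  then show ?thesis by (simp add: grid_coeff_def)
qed

text \<open>The addition theorem for the cosine splits the coefficient into two values of the quadratic form of
  \<open>k\<close>, one for the weights \<open>cos\<close> and one for the weights \<open>sin\<close>.\<close>

lemma grid_coeff_nonneg:
  assumes "\<And>c. 0 \<le> (\<Sum>g\<in>box_grid r. \<Sum>h\<in>box_grid r. c g * c h * k g h)"
  shows "0 \<le> grid_coeff r k u"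
proof -
  have "(\<Sum>g\<in>box_grid r. \<Sum>h\<in>box_grid r. cos (phase r u (\<lambda>i. g i - h i)) * k g h) =
    (\<Sum>g\<in>box_grid r. \<Sum>h\<in>box_grid r. cos (phase r u g) * cos (phase r u h) * k g h) +
    (\<Sum>g\<in>box_grid r. \<Sum>h\<in>box_grid r. sin (phase r u g) * sin (phase r u h) * k g h)"
    by (simp add: phase_diff cos_diff sum.distrib distrib_right)
  also have "\<dots> \<ge> 0" using assms by (intro add_nonneg_nonneg) auto
  finally show ?thesis by (simp add: grid_coeff_def)
qed

text \<open>Orthogonality of the characters: the sum over \<open>u\<close> of \<open>cos (2 \<pi> u\<^bold>\<cdot>(g - h) / M) cos (2 \<pi> u\<^bold>\<cdot>q / M)\<close>
  selects the pairs with \<open>h \<equiv> g + q\<close> and those with \<open>h \<equiv> g - q\<close>, with weight one half each. By symmetry of \<open>k\<close> and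
  translation invariance of the grid, both selections give the same value.\<close>

lemma grid_coeff_inversion:
  fixes k :: "('n::finite \<Rightarrow> int) \<Rightarrow> ('n \<Rightarrow> int) \<Rightarrow> real"
  assumes per: "\<And>p q s. k (\<lambda>i. p i + (2 * int r + 1) * s i) q = k p q"
    and sym: "\<And>p q. k p q = k q p"
  shows "(\<Sum>u\<in>box_grid r. grid_coeff r k u * cos (phase r u q)) =
    (\<Sum>g\<in>box_grid r. k g (\<lambda>i. g i + q i)) / real (2 * r + 1) ^ CARD('n)"
proof -
  define G :: "('n \<Rightarrow> int) set" where "G = box_grid r"
  define M where "M = real (2 * r + 1) ^ CARD('n)"
  have per2: "k p (\<lambda>i. q i + (2 * int r + 1) * s i) = k p q" for p q s
    using per[of q s p] by (simp add: sym)
  have M0: "M > 0" by (simp add: M_def)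
  define E where "E d = (if \<forall>i. 2 * int r + 1 dvd d i then 1 else 0 :: real)" for d :: "'n \<Rightarrow> int"
  have orth: "(\<Sum>u\<in>G. cos (phase r u a) * cos (phase r u q)) =
      M / 2 * (E (\<lambda>i. a i + q i) + E (\<lambda>i. a i - q i))" for a
  proof -
    have "(\<Sum>u\<in>G. cos (phase r u a) * cos (phase r u q)) =
       (\<Sum>u\<in>G. cos (phase r u (\<lambda>i. a i - q i)) / 2 + cos (phase r u (\<lambda>i. a i + q i)) / 2)"
      by (intro sum.cong refl) (simp add: phase_add phase_diff cos_add cos_diff field_simps)
    also have "\<dots> = (\<Sum>u\<in>G. cos (phase r u (\<lambda>i. a i - q i))) / 2 + (\<Sum>u\<in>G. cos (phase r u (\<lambda>i. a i + q i))) / 2"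
      by (simp add: sum.distrib sum_divide_distrib)
    also have "\<dots> = M / 2 * (E (\<lambda>i. a i + q i) + E (\<lambda>i. a i - q i))"
      unfolding G_def character_sum by (simp add: E_def M_def field_simps)
    finally show ?thesis .
  qed
  have pick: "(\<Sum>h\<in>G. k g h * E (\<lambda>i. p i - h i)) = k g p" for g p
  proof -
    have "(\<Sum>h\<in>G. k g h * E (\<lambda>i. p i - h i)) = (\<Sum>h\<in>{grid_reduce r p}. k g h * E (\<lambda>i. p i - h i))"
    proof (rule sum.mono_neutral_right)
      show "\<forall>h\<in>G - {grid_reduce r p}. k g h * E (\<lambda>i. p i - h i) = 0"
      proof
        fix h assume h: "h \<in> G - {grid_reduce r p}"
        have "\<not> (\<forall>i. 2 * int r + 1 dvd p i - h i)"
        proof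
          assume "\<forall>i. 2 * int r + 1 dvd p i - h i"
          then have "2 * int r + 1 dvd (p i - grid_reduce r p i) - (p i - h i)" for i
            by (intro dvd_diff[OF dvd_grid_reduce]) simp
          then have "h = grid_reduce r p"
            using h by (intro box_grid_eqI[OF _ grid_reduce_in_box]) (auto simp: G_def)
          with h show False by simp
        qed
        then show "k g h * E (\<lambda>i. p i - h i) = 0" by (auto simp: E_def)
      qed
    qed (auto simp: G_def grid_reduce_in_box)
    also have "\<dots> = k g (grid_reduce r p)"
      by (simp add: E_def dvd_grid_reduce)
    also have "\<dots> = k g p" unfolding grid_reduce_eq by (rule per2)
    finally show ?thesis .
  qed
  have backward: "(\<Sum>g\<in>G. k g (\<lambda>i. g i - q i)) = (\<Sum>g\<in>G. k g (\<lambda>i. g i + q i))"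
  proof -
    have "(\<Sum>g\<in>G. k (\<lambda>i. g i + q i) (\<lambda>i. (g i + q i) - q i)) = (\<Sum>g\<in>G. k g (\<lambda>i. g i - q i))"
      unfolding G_def
    proof (rule sum_box_grid_shift[of "\<lambda>g. k g (\<lambda>i. g i - q i)"])
      fix p s :: "'n \<Rightarrow> int"
      show "k (\<lambda>i. p i + (2 * int r + 1) * s i) (\<lambda>i. p i + (2 * int r + 1) * s i - q i) =
          k p (\<lambda>i. p i - q i)"
        using per2[of p "\<lambda>i. p i - q i" s] unfolding per by (simp add: algebra_simps)
    qed
    moreover have "k (\<lambda>i. g i + q i) (\<lambda>i. (g i + q i) - q i) = k g (\<lambda>i. g i + q i)" for g
      using sym[of "\<lambda>i. g i + q i" g] by simp
    ultimately show ?thesis by simp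
  qed
  have coeff: "grid_coeff r k u = (\<Sum>g\<in>G. \<Sum>h\<in>G. cos (phase r u (\<lambda>i. g i - h i)) * k g h) / M\<^sup>2" for u
    unfolding grid_coeff_def M_def G_def ..
  have "(\<Sum>u\<in>G. grid_coeff r k u * cos (phase r u q)) * M\<^sup>2 =
     (\<Sum>u\<in>G. \<Sum>g\<in>G. \<Sum>h\<in>G. k g h * (cos (phase r u (\<lambda>i. g i - h i)) * cos (phase r u q)))"
    unfolding sum_distrib_right
  proof (rule sum.cong[OF refl])
    fix u
    have "grid_coeff r k u * cos (phase r u q) * M\<^sup>2 = 
        (\<Sum>g\<in>G. \<Sum>h\<in>G. cos (phase r u (\<lambda>i. g i - h i)) * k g h) * cos (phase r u q)"
      using M0 by (simp add: coeff)
    also have "\<dots> = (\<Sum>g\<in>G. \<Sum>h\<in>G. k g h * (cos (phase r u (\<lambda>i. g i - h i)) * cos (phase r u q)))"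
      by (simp add: sum_distrib_left mult_ac)
    finally show "grid_coeff r k u * cos (phase r u q) * M\<^sup>2 =
        (\<Sum>g\<in>G. \<Sum>h\<in>G. k g h * (cos (phase r u (\<lambda>i. g i - h i)) * cos (phase r u q)))" .
  qed
  also have "\<dots> = (\<Sum>g\<in>G. \<Sum>u\<in>G. \<Sum>h\<in>G. k g h * (cos (phase r u (\<lambda>i. g i - h i)) * cos (phase r u q)))"
    by (rule sum.swap)
  also have "\<dots> = (\<Sum>g\<in>G. \<Sum>h\<in>G. \<Sum>u\<in>G. k g h * (cos (phase r u (\<lambda>i. g i - h i)) * cos (phase r u q)))"
    by (intro sum.cong refl sum.swap)
  also have "\<dots> = (\<Sum>g\<in>G. \<Sum>h\<in>G. k g h * (M / 2 * (E (\<lambda>i. (g i + q i) - h i) + E (\<lambda>i. (g i - q i) - h i))))"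
    unfolding sum_distrib_left[symmetric] orth by (simp add: algebra_simps)
  also have "\<dots> = M / 2 * ((\<Sum>g\<in>G. \<Sum>h\<in>G. k g h * E (\<lambda>i. (g i + q i) - h i)) +
      (\<Sum>g\<in>G. \<Sum>h\<in>G. k g h * E (\<lambda>i. (g i - q i) - h i)))"
    by (simp add: distrib_left sum.distrib sum_distrib_left mult_ac)
  also have "\<dots> = M * (\<Sum>g\<in>G. k g (\<lambda>i. g i + q i))"
    by (simp add: pick[of _ "\<lambda>i. _ i + q i"] pick[of _ "\<lambda>i. _ i - q i"] backward)
  finally have "(\<Sum>u\<in>G. grid_coeff r k u * cos (phase r u q)) = (\<Sum>g\<in>G. k g (\<lambda>i. g i + q i)) / M"
    using M0 by (simp add: field_simps power2_eq_square)
  then show ?thesis unfolding G_def M_def .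
qed

text \<open>When \<open>k\<close> is the real part of a Gram kernel, the summand on the right is the squared distance between the
  images of \<open>g + q\<close> and \<open>g\<close>; so this is the cosine expansion of the averaged squared distance.\<close>

lemma grid_mean_square_difference:
  fixes k :: "('n::finite \<Rightarrow> int) \<Rightarrow> ('n \<Rightarrow> int) \<Rightarrow> real"
  assumes per: "\<And>p q s. k (\<lambda>i. p i + (2 * int r + 1) * s i) q = k p q"
    and sym: "\<And>p q. k p q = k q p"
  shows "(\<Sum>u\<in>box_grid r. 2 * (grid_coeff r k u * (1 - cos (phase r u q)))) =
    (\<Sum>g\<in>box_grid r. k (\<lambda>i. g i + q i) (\<lambda>i. g i + q i) + k g g - 2 * k (\<lambda>i. g i + q i) g)
      / real (2 * r + 1) ^ CARD('n)"
proof -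
  have inv0: "(\<Sum>u\<in>box_grid r. grid_coeff r k u) = (\<Sum>g\<in>box_grid r. k g g) / real (2 * r + 1) ^ CARD('n)"
    using grid_coeff_inversion[of k r "\<lambda>i. 0", OF per sym] by (simp add: phase_int)
  have shift: "(\<Sum>g\<in>box_grid r. k (\<lambda>i. g i + q i) (\<lambda>i. g i + q i)) = (\<Sum>g\<in>box_grid r. k g g)"
  proof (rule sum_box_grid_shift[of "\<lambda>g. k g g"])
    fix p s :: "'n \<Rightarrow> int"
    have "k (\<lambda>i. p i + (2 * int r + 1) * s i) (\<lambda>i. p i + (2 * int r + 1) * s i) =
        k p (\<lambda>i. p i + (2 * int r + 1) * s i)"
      by (rule per)
    also have "\<dots> = k (\<lambda>i. p i + (2 * int r + 1) * s i) p" by (rule sym)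
    also have "\<dots> = k p p" by (rule per)
    finally show "k (\<lambda>i. p i + (2 * int r + 1) * s i) (\<lambda>i. p i + (2 * int r + 1) * s i) = k p p" .
  qed
  have sym_shift: "k (\<lambda>i. g i + q i) g = k g (\<lambda>i. g i + q i)" for g by (rule sym)
  have "(\<Sum>u\<in>box_grid r. 2 * (grid_coeff r k u * (1 - cos (phase r u q)))) =
    2 * ((\<Sum>u\<in>box_grid r. grid_coeff r k u) - (\<Sum>u\<in>box_grid r. grid_coeff r k u * cos (phase r u q)))"
    by (simp add: right_diff_distrib sum_subtractf sum_distrib_left)
  also have "\<dots> = (2 * (\<Sum>g\<in>box_grid r. k g g) - 2 * (\<Sum>g\<in>box_grid r. k g (\<lambda>i. g i + q i)))
      / real (2 * r + 1) ^ CARD('n)"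
    unfolding inv0 grid_coeff_inversion[of k r q, OF per sym] by (simp add: diff_divide_distrib)
  also have "2 * (\<Sum>g\<in>box_grid r. k g g) - 2 * (\<Sum>g\<in>box_grid r. k g (\<lambda>i. g i + q i)) =
     (\<Sum>g\<in>box_grid r. k (\<lambda>i. g i + q i) (\<lambda>i. g i + q i) + k g g - 2 * k (\<lambda>i. g i + q i) g)"
    by (simp add: sum_subtractf sum.distrib shift sum_distrib_left sym_shift)
  finally show ?thesis .
qed

section \<open>The spectrum of a periodic positive semidefinite kernel\<close>

lemma cos_le_quartic: "cos (x::real) \<le> 1 - x\<^sup>2 / 2 + x ^ 4 / 24"
proof -
  obtain t where "cos x = (\<Sum>m<4. cos_coeff m * x ^ m) + (cos (t + 1/2 * real 4 * pi) / fact 4) * x ^ 4"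
    using Maclaurin_cos_expansion[of x 4] by auto
  moreover have "(\<Sum>m<4. cos_coeff m * x ^ m) = 1 - x\<^sup>2 / 2"
  proof -
    have "{..<4::nat} = {0, 1, 2, 3}" by auto
    then show ?thesis by (simp add: cos_coeff_def)
  qed
  moreover have "(cos (t + 1/2 * real 4 * pi) / fact 4) * x ^ 4 \<le> 1 / 24 * x ^ 4"
    by (intro mult_right_mono) (auto simp: fact_numeral)
  ultimately show ?thesis by simp
qed

lemma one_minus_cos_lower:
  assumes "\<bar>x\<bar> \<le> pi"
  shows "x\<^sup>2 / 14 \<le> 1 - cos x"
proof -
  have "\<bar>x\<bar> \<le> 16/5" using assms pi_approx by simp
  then have x2: "x\<^sup>2 \<le> (16/5)\<^sup>2" using abs_le_square_iff[of x "16/5"] by simp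
  have "x ^ 4 = x\<^sup>2 * x\<^sup>2" by (simp add: power4_eq_xxxx power2_eq_square)
  also have "x\<^sup>2 * x\<^sup>2 \<le> x\<^sup>2 * (16/5)\<^sup>2" using x2 by (intro mult_left_mono) auto
  finally have "x ^ 4 \<le> 256/25 * x\<^sup>2" by (simp add: power_divide)
  with cos_le_quartic[of x] zero_le_power2[of x] show ?thesis by argo
qed

lemma norm_ivec_ge_1:
  assumes "u \<noteq> (\<lambda>i. 0)"
  shows "1 \<le> (norm (ivec u :: real^'n))\<^sup>2"
proof -
  obtain i where i: "u i \<noteq> 0" using assms by auto
  have "1 \<le> \<bar>real_of_int (u i)\<bar>" using i by (metis of_int_1_le_iff of_int_abs abs_ge_zero zero_less_abs_iff int_one_le_iff_zero_less)
  also have "\<dots> \<le> norm (ivec u :: real^'n)"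
    using component_le_norm_cart[of "ivec u" i] by (simp add: ivec_def)
  finally show ?thesis by (simp add: power_mono[of 1 _ 2, simplified])
qed

lemma norm_ivec_outside_box:
  assumes "u \<notin> box_grid N"
  shows "(real N)\<^sup>2 \<le> (norm (ivec u :: real^'n))\<^sup>2"
proof -
  obtain i where "\<not> (- int N \<le> u i \<and> u i \<le> int N)" using assms by (auto simp: mem_box_grid)
  then have "int N \<le> \<bar>u i\<bar>" by linarith
  then have "real_of_int (int N) \<le> real_of_int \<bar>u i\<bar>" by (simp only: of_int_le_iff)
  then have "real N \<le> \<bar>ivec u $ i\<bar>" by (simp add: ivec_def)
  also have "\<dots> \<le> norm (ivec u :: real^'n)" by (rule component_le_norm_cart)
  finally show ?thesis by (intro power_mono) auto
qed

text \<open>The squared distance of \<open>k\<close> is averaged over the grid of mesh \<open>1/M\<close>, and the coefficients \<open>w\<close> are a limit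
  along a subsequence of the grid coefficients. The bound for finite sums passes to the limit
  directly. For the lower bound, the second moment bound \<open>c\<close> controls the part of the
  series outside the box of size \<open>N\<close> by \<open>4 c / N\<^sup>2\<close>, uniformly in the grid. The conclusion avoids infinite
  sums on purpose: finite sums from above and approximation from below are what the limit yields, and
  infinite sums over the dual lattice are easily recovered from them.\<close>

proposition periodic_kernel_spectrum:
  fixes k :: "real^'n \<Rightarrow> real^'n \<Rightarrow> real" and T :: "real^'n \<Rightarrow> real^'n" and m :: "real^'n \<Rightarrow> real"
  assumes per: "\<And>x y v. v \<in> int_vectors \<Longrightarrow> k (x + v) y = k x y"
    and sym: "\<And>x y. k x y = k y x"
    and psd: "\<And>A c. finite A \<Longrightarrow> 0 \<le> (\<Sum>x\<in>A. \<Sum>y\<in>A. c x * c y * k x y)"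
    and linT: "linear T"
    and upper: "\<And>x y. k x x + k y y - 2 * k x y \<le> (norm (T (x - y)))\<^sup>2"
    and lower: "\<And>x y. m (x - y) \<le> k x x + k y y - 2 * k x y"
    and m_cont: "continuous_on UNIV m"
  obtains w :: "('n \<Rightarrow> int) \<Rightarrow> real" and c where
    "\<And>u. 0 \<le> w u" "\<And>u. w (\<lambda>i. - u i) = w u"
    "\<And>F. finite F \<Longrightarrow> (\<Sum>u\<in>F. w u * (norm (ivec u))\<^sup>2) \<le> c"
    "\<And>F. finite F \<Longrightarrow> (\<Sum>u\<in>F. w u) \<le> c"
    "\<And>F x. finite F \<Longrightarrow> (\<Sum>u\<in>F. 2 * (w u * (1 - cos (2 * pi * (ivec u \<bullet> x))))) \<le> (norm (T x))\<^sup>2"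
    "\<And>x \<epsilon>. 0 < \<epsilon> \<Longrightarrow> \<exists>F. finite F \<and> m x \<le> (\<Sum>u\<in>F. 2 * (w u * (1 - cos (2 * pi * (ivec u \<bullet> x))))) + \<epsilon>"
proof -
  define M where "M r = real (2 * r + 1)" for r
  have M0: "0 < M r" for r by (simp add: M_def)
  define \<kappa> where "\<kappa> r p q = k (ivec p /\<^sub>R M r) (ivec q /\<^sub>R M r)" for r p q
  have \<kappa>_per: "\<kappa> r (\<lambda>i. p i + (2 * int r + 1) * s i) q = \<kappa> r p q" for r p s q
  proof -
    have "ivec (\<lambda>i. p i + (2 * int r + 1) * s i) = ivec p + M r *\<^sub>R (ivec s :: real^'n)"
      by (simp add: ivec_def vec_eq_iff M_def)
    then have "ivec (\<lambda>i. p i + (2 * int r + 1) * s i) /\<^sub>R M r = ivec p /\<^sub>R M r + (ivec s :: real^'n)"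
      using M0[of r] by (simp add: scaleR_right_distrib)
    then show ?thesis by (simp add: \<kappa>_def per ivec_def int_vectors_def)
  qed
  have \<kappa>_sym: "\<kappa> r p q = \<kappa> r q p" for r p q unfolding \<kappa>_def by (rule sym)
  define z where "z r = grid_coeff r (\<kappa> r)" for r
  have z0: "0 \<le> z r u" for r u
    unfolding z_def
  proof (rule grid_coeff_nonneg)
    fix c :: "('n \<Rightarrow> int) \<Rightarrow> real"
    define f where "f p = (ivec p /\<^sub>R M r :: real^'n)" for p
    have "inj f"
      using M0[of r] by (auto intro!: injI simp: f_def ivec_def vec_eq_iff)
    then have inj: "inj_on f A" for A by (rule inj_on_subset) simp
    have "0 \<le> (\<Sum>x\<in>f ` box_grid r. \<Sum>y\<in>f ` box_grid r.
        c (inv_into UNIV f x) * c (inv_into UNIV f y) * k x y)"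
      by (rule psd) simp
    also have "\<dots> = (\<Sum>g\<in>box_grid r. \<Sum>h\<in>box_grid r. c g * c h * \<kappa> r g h)"
      by (simp add: sum.reindex[OF inj] inv_f_f[OF \<open>inj f\<close>] \<kappa>_def f_def[symmetric])
    finally show "0 \<le> (\<Sum>g\<in>box_grid r. \<Sum>h\<in>box_grid r. c g * c h * \<kappa> r g h)" .
  qed
  define S where "S r q = (\<Sum>u\<in>box_grid r. 2 * (z r u * (1 - cos (2 * pi * (ivec u \<bullet> (ivec q /\<^sub>R M r))))))" for r q
  have phase: "phase r u q = 2 * pi * (ivec u \<bullet> (ivec q /\<^sub>R M r))" for r q and u :: "'n \<Rightarrow> int"
    by (simp add: phase_def M_def divide_inverse)
  have S_eq: "S r q = (\<Sum>g\<in>box_grid r. \<kappa> r (\<lambda>i. g i + q i) (\<lambda>i. g i + q i) + \<kappa> r g g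
      - 2 * \<kappa> r (\<lambda>i. g i + q i) g) / M r ^ CARD('n)" for r q
  proof -
    have "S r q = (\<Sum>u\<in>box_grid r. 2 * (grid_coeff r (\<kappa> r) u * (1 - cos (phase r u q))))"
      by (simp only: S_def z_def phase)
    also note grid_mean_square_difference[OF \<kappa>_per \<kappa>_sym]
    finally show ?thesis by (simp only: M_def)
  qed
  have diff: "ivec (\<lambda>i. g i + q i) /\<^sub>R M r - ivec g /\<^sub>R M r = (ivec q /\<^sub>R M r :: real^'n)" for g q r
    by (simp add: ivec_def vec_eq_iff algebra_simps)
  have cardM: "(\<Sum>g\<in>(box_grid r :: ('n \<Rightarrow> int) set). a) = M r ^ CARD('n) * a" for r and a :: real
    by (simp add: card_box_grid M_def)
  have S_upper: "S r q \<le> (norm (T (ivec q /\<^sub>R M r)))\<^sup>2" for r q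
  proof -
    have "(\<Sum>g\<in>box_grid r. \<kappa> r (\<lambda>i. g i + q i) (\<lambda>i. g i + q i) + \<kappa> r g g - 2 * \<kappa> r (\<lambda>i. g i + q i) g)
        \<le> (\<Sum>g\<in>(box_grid r :: ('n \<Rightarrow> int) set). (norm (T (ivec q /\<^sub>R M r)))\<^sup>2)"
      unfolding \<kappa>_def by (intro sum_mono order_trans[OF upper]) (simp add: diff)
    then show ?thesis
      unfolding S_eq cardM using M0[of r] by (simp add: divide_le_eq mult.commute)
  qed
  have S_lower: "m (ivec q /\<^sub>R M r) \<le> S r q" for r q
  proof -
    have "(\<Sum>g\<in>(box_grid r :: ('n \<Rightarrow> int) set). m (ivec q /\<^sub>R M r)) \<le>
        (\<Sum>g\<in>box_grid r. \<kappa> r (\<lambda>i. g i + q i) (\<lambda>i. g i + q i) + \<kappa> r g g - 2 * \<kappa> r (\<lambda>i. g i + q i) g)"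
      unfolding \<kappa>_def by (intro sum_mono order_trans[OF _ lower]) (simp add: diff)
    then show ?thesis
      unfolding S_eq cardM using M0[of r] by (simp add: le_divide_eq mult.commute)
  qed

  \<comment> \<open>Tightness: the upper bound at the single grid step along the \<open>i\<close>-th axis, where
    \<open>1 - cos (2 \<pi> u\<^sub>i / M)\<close> is at least a fixed multiple of \<open>(u\<^sub>i / M)\<^sup>2\<close>. The factors \<open>M\<^sup>2\<close> cancel.\<close>
  define c where "c = (\<Sum>i\<in>UNIV. (norm (T (axis i 1)))\<^sup>2)"
  have tight: "(\<Sum>u\<in>box_grid r. z r u * (norm (ivec u :: real^'n))\<^sup>2) \<le> c" for r
  proof -
    have coord: "(\<Sum>u\<in>box_grid r. z r u * (real_of_int (u i))\<^sup>2) \<le> (norm (T (axis i 1)))\<^sup>2" for i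
    proof -
      define q where "q l = (if l = i then 1 else 0 :: int)" for l :: 'n
      have q: "ivec q = (axis i 1 :: real^'n)"
        by (simp add: ivec_def q_def axis_def vec_eq_iff)
      have term_le: "z r u * (real_of_int (u i))\<^sup>2 / (M r)\<^sup>2 \<le>
          2 * (z r u * (1 - cos (2 * pi * (ivec u \<bullet> (ivec q /\<^sub>R M r)))))" if "u \<in> box_grid r" for u
      proof -
        have "\<bar>u i\<bar> \<le> int r" using that unfolding mem_box_grid by (simp add: abs_le_iff) (smt (verit))
        then have "real_of_int \<bar>u i\<bar> \<le> real_of_int (int r)" by (simp only: of_int_le_iff)
        then have ui: "2 * \<bar>real_of_int (u i)\<bar> \<le> M r" by (simp add: M_def)
        define \<theta> where "\<theta> = 2 * pi * (real_of_int (u i) / M r)"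
        have eq: "2 * pi * (ivec u \<bullet> (ivec q /\<^sub>R M r)) = \<theta>"
          by (simp add: q inner_axis \<theta>_def) (simp add: ivec_def divide_inverse)
        have "\<bar>\<theta>\<bar> = pi * (2 * \<bar>real_of_int (u i)\<bar> / M r)"
          using M0[of r] by (simp add: \<theta>_def abs_mult)
        also have "\<dots> \<le> pi * 1"
          using ui M0[of r] by (intro mult_left_mono) (auto simp: divide_le_eq)
        finally have lower_cos: "\<theta>\<^sup>2 / 14 \<le> 1 - cos \<theta>" by (intro one_minus_cos_lower) simp
        have \<theta>2: "\<theta>\<^sup>2 = (4 * pi\<^sup>2) * (real_of_int (u i) / M r)\<^sup>2"
          by (simp add: \<theta>_def power_mult_distrib power_divide)
        have "7 * (real_of_int (u i) / M r)\<^sup>2 \<le> (4 * pi\<^sup>2) * (real_of_int (u i) / M r)\<^sup>2"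
        proof (rule mult_right_mono)
          have "(3::real)\<^sup>2 \<le> pi\<^sup>2" using pi_approx by (intro power_mono) auto
          then show "7 \<le> 4 * pi\<^sup>2" by simp
        qed simp
        then have "7 * (real_of_int (u i) / M r)\<^sup>2 \<le> \<theta>\<^sup>2" by (simp only: \<theta>2)
        with lower_cos have "(real_of_int (u i) / M r)\<^sup>2 \<le> 2 * (1 - cos \<theta>)" by argo
        then have "z r u * (real_of_int (u i) / M r)\<^sup>2 \<le> z r u * (2 * (1 - cos \<theta>))"
          by (intro mult_left_mono z0)
        then show ?thesis unfolding eq by (simp add: power_divide algebra_simps)
      qed
      have "(\<Sum>u\<in>box_grid r. z r u * (real_of_int (u i))\<^sup>2 / (M r)\<^sup>2) \<le> S r q"
        unfolding S_def by (intro sum_mono term_le)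
      also have "\<dots> \<le> (norm (T (ivec q /\<^sub>R M r)))\<^sup>2" by (rule S_upper)
      also have "\<dots> = (norm (T (axis i 1)))\<^sup>2 / (M r)\<^sup>2"
        using M0[of r] by (simp add: q linear_scale[OF linT] power_mult_distrib power_inverse divide_inverse)
      finally show ?thesis
        using M0[of r] by (simp add: sum_divide_distrib[symmetric] divide_le_cancel)
    qed
    have "(\<Sum>u\<in>box_grid r. z r u * (norm (ivec u :: real^'n))\<^sup>2) =
        (\<Sum>u\<in>box_grid r. \<Sum>i\<in>UNIV. z r u * (real_of_int (u i))\<^sup>2)"
      unfolding power2_norm_eq_inner inner_vec_def sum_distrib_left
      by (simp add: ivec_def power2_eq_square)
    also have "\<dots> = (\<Sum>i\<in>UNIV. \<Sum>u\<in>box_grid r. z r u * (real_of_int (u i))\<^sup>2)"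
      by (rule sum.swap)
    also have "\<dots> \<le> c" unfolding c_def by (intro sum_mono coord)
    finally show ?thesis .
  qed

  \<comment> \<open>The second moment controls every coefficient except the one at 0, where the cosine term vanishes. With
    that one set to 0, all coefficients are bounded by \<open>c\<close>, as the choice of a convergent subsequence requires.\<close>
  define W where "W r u = (if u \<in> box_grid r \<and> u \<noteq> (\<lambda>i. 0) then z r u else 0)" for r and u :: "'n \<Rightarrow> int"
  have W0: "0 \<le> W r u" for r u by (simp add: W_def z0)
  have W_tight: "(\<Sum>u\<in>F. W r u * (norm (ivec u :: real^'n))\<^sup>2) \<le> c" if "finite F" for F r
  proof -
    have "(\<Sum>u\<in>F. W r u * (norm (ivec u :: real^'n))\<^sup>2) = (\<Sum>u\<in>F \<inter> box_grid r. W r u * (norm (ivec u :: real^'n))\<^sup>2)"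
      using that by (intro sum.mono_neutral_right) (auto simp: W_def)
    also have "\<dots> \<le> (\<Sum>u\<in>F \<inter> box_grid r. z r u * (norm (ivec u :: real^'n))\<^sup>2)"
      by (intro sum_mono mult_right_mono) (auto simp: W_def z0)
    also have "\<dots> \<le> (\<Sum>u\<in>box_grid r. z r u * (norm (ivec u :: real^'n))\<^sup>2)"
      by (intro sum_mono2) (auto simp: z0)
    also have "\<dots> \<le> c" by (rule tight)
    finally show ?thesis .
  qed
  have W_le: "W r u \<le> W r u * (norm (ivec u :: real^'n))\<^sup>2" for r u
  proof (cases "u = (\<lambda>i. 0)")
    case False
    show ?thesis using mult_left_mono[OF norm_ivec_ge_1[OF False] W0[of r u]] by simp
  qed (simp add: W_def)
  have W_bound: "norm (W r u) \<le> c" for r u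
    using W_tight[of "{u}" r] W_le[of r u] W0[of r u] by simp
  have W_sum: "(\<Sum>u\<in>F. W r u) \<le> c" if "finite F" for F r
    using W_tight[OF that, of r] sum_mono[of F "W r", OF W_le] by (rule order_trans[rotated])
  obtain \<sigma> where \<sigma>: "strict_mono \<sigma>" and "\<And>u. u \<in> UNIV \<Longrightarrow> \<exists>l. (\<lambda>n. W (\<sigma> n) u) \<longlonglongrightarrow> l"
    using function_convergent_subsequence[of "UNIV :: ('n \<Rightarrow> int) set" W c] W_bound by auto
  then have "\<forall>u. \<exists>l. (\<lambda>n. W (\<sigma> n) u) \<longlonglongrightarrow> l" by simp
  then obtain w where w: "\<And>u. (\<lambda>n. W (\<sigma> n) u) \<longlonglongrightarrow> w u" unfolding choice_iff by blast

  \<comment> \<open>The expansion at level \<open>r\<close> is exact only at grid points, so \<open>x\<close> is rounded to the grid.\<close>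
  define approx where "approx x r = (\<lambda>i. \<lfloor>M r * x $ i\<rfloor>)" for x :: "real^'n" and r
  define X where "X x n = (ivec (approx x (\<sigma> n)) /\<^sub>R M (\<sigma> n) :: real^'n)" for x n
  have X: "X x \<longlonglongrightarrow> x" for x
  proof (rule vec_tendstoI)
    fix i
    have "real (Suc n) \<le> M (\<sigma> n)" for n
      using seq_suble[OF \<sigma>, of n] by (simp add: M_def)
    then have inv_le: "inverse (M (\<sigma> n)) \<le> inverse (real (Suc n))" for n
      by (intro le_imp_inverse_le) simp_all
    have inv0: "(\<lambda>n. inverse (M (\<sigma> n))) \<longlonglongrightarrow> 0"
    proof (rule tendsto_sandwich)
      show "\<forall>\<^sub>F n in sequentially. 0 \<le> inverse (M (\<sigma> n))"
        using less_imp_le[OF M0] by (intro always_eventually allI) simp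
      show "\<forall>\<^sub>F n in sequentially. inverse (M (\<sigma> n)) \<le> inverse (real (Suc n))"
        by (intro always_eventually allI inv_le)
      show "(\<lambda>n. inverse (real (Suc n))) \<longlonglongrightarrow> 0" by (rule LIMSEQ_inverse_real_of_nat)
    qed (rule tendsto_const)
    have "norm (X x n $ i - x $ i) \<le> inverse (M (\<sigma> n)) * 1" for n
    proof -
      have "X x n $ i - x $ i = inverse (M (\<sigma> n)) * (of_int \<lfloor>M (\<sigma> n) * x $ i\<rfloor> - M (\<sigma> n) * x $ i)"
        using M0[of "\<sigma> n"] by (simp add: X_def approx_def ivec_def field_simps)
      also have "norm \<dots> = inverse (M (\<sigma> n)) * \<bar>of_int \<lfloor>M (\<sigma> n) * x $ i\<rfloor> - M (\<sigma> n) * x $ i\<bar>"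
        using M0[of "\<sigma> n"] by (simp add: abs_mult)
      also have "\<dots> \<le> inverse (M (\<sigma> n)) * 1"
        using M0[of "\<sigma> n"] by (intro mult_left_mono) (auto simp: abs_le_iff, linarith+)
      finally show ?thesis .
    qed
    then have "\<forall>\<^sub>F n in sequentially. norm (X x n $ i - x $ i) \<le> inverse (M (\<sigma> n))"
      by (intro always_eventually allI) simp
    then have "(\<lambda>n. X x n $ i - x $ i) \<longlonglongrightarrow> 0"
      using inv0 by (rule Lim_null_comparison)
    then show "(\<lambda>n. X x n $ i) \<longlonglongrightarrow> x $ i" by (simp add: LIM_zero_iff)
  qed
  have partial: "(\<lambda>n. \<Sum>u\<in>F. 2 * (W (\<sigma> n) u * (1 - cos (2 * pi * (ivec u \<bullet> X x n))))) \<longlonglongrightarrow>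
      (\<Sum>u\<in>F. 2 * (w u * (1 - cos (2 * pi * (ivec u \<bullet> x)))))" for F x
    by (intro tendsto_intros w X)
  have z_W: "z r u * (1 - cos (2 * pi * (ivec u \<bullet> y))) = W r u * (1 - cos (2 * pi * (ivec u \<bullet> y)))"
    if "u \<in> box_grid r" for r u and y :: "real^'n"
    using that by (cases "u = (\<lambda>i. 0)") (simp_all add: W_def ivec_def inner_vec_def)
  have S_W: "S r q = (\<Sum>u\<in>box_grid r. 2 * (W r u * (1 - cos (2 * pi * (ivec u \<bullet> (ivec q /\<^sub>R M r))))))" for r q
    unfolding S_def by (intro sum.cong refl) (simp only: z_W)

  show thesis
  proof (rule that[of w c])
    show "0 \<le> w u" for u
      using w[of u] W0 by (intro LIMSEQ_le_const) auto
    show "w (\<lambda>i. - u i) = w u" for u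
    proof -
      have "(\<lambda>i. - u i) = (\<lambda>i. 0) \<longleftrightarrow> u = (\<lambda>i. 0)" by (auto simp: fun_eq_iff)
      moreover have "(\<lambda>i. - u i) \<in> box_grid r \<longleftrightarrow> u \<in> box_grid r" for r
        unfolding mem_box_grid by (rule iff_allI) auto
      ultimately have "W r (\<lambda>i. - u i) = W r u" for r
        by (simp add: W_def z_def grid_coeff_minus)
      then show ?thesis using w[of u] w[of "\<lambda>i. - u i"] LIMSEQ_unique by simp
    qed
    show "(\<Sum>u\<in>F. w u * (norm (ivec u :: real^'n))\<^sup>2) \<le> c" if "finite F" for F
    proof (rule LIMSEQ_le_const2)
      show "(\<lambda>n. \<Sum>u\<in>F. W (\<sigma> n) u * (norm (ivec u :: real^'n))\<^sup>2) \<longlonglongrightarrow> (\<Sum>u\<in>F. w u * (norm (ivec u :: real^'n))\<^sup>2)"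
        by (intro tendsto_intros w)
    qed (use W_tight[OF that] in auto)
    show "(\<Sum>u\<in>F. w u) \<le> c" if "finite F" for F
    proof (rule LIMSEQ_le_const2)
      show "(\<lambda>n. \<Sum>u\<in>F. W (\<sigma> n) u) \<longlonglongrightarrow> (\<Sum>u\<in>F. w u)"
        by (intro tendsto_intros w)
    qed (use W_sum[OF that] in auto)
    show "(\<Sum>u\<in>F. 2 * (w u * (1 - cos (2 * pi * (ivec u \<bullet> x))))) \<le> (norm (T x))\<^sup>2"
      if "finite F" for F and x :: "real^'n"
    proof (rule LIMSEQ_le[OF partial])
      have "isCont T x" using linT by (simp add: linear_continuous_at linear_conv_bounded_linear)
      then show "(\<lambda>n. (norm (T (X x n)))\<^sup>2) \<longlonglongrightarrow> (norm (T x))\<^sup>2"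
        by (intro tendsto_intros isCont_tendsto_compose[of x T] X)
      have "(\<Sum>u\<in>F. 2 * (W (\<sigma> n) u * (1 - cos (2 * pi * (ivec u \<bullet> X x n))))) \<le> (norm (T (X x n)))\<^sup>2" for n
      proof -
        have "(\<Sum>u\<in>F. 2 * (W (\<sigma> n) u * (1 - cos (2 * pi * (ivec u \<bullet> X x n))))) =
          (\<Sum>u\<in>F \<inter> box_grid (\<sigma> n). 2 * (W (\<sigma> n) u * (1 - cos (2 * pi * (ivec u \<bullet> X x n)))))"
          using that by (intro sum.mono_neutral_right) (auto simp: W_def)
        also have "\<dots> \<le> S (\<sigma> n) (approx x (\<sigma> n))"
          unfolding S_W X_def[symmetric] 
          by (intro sum_mono2) (auto intro!: mult_nonneg_nonneg W0 one_minus_cos_bounds)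
        also have "\<dots> \<le> (norm (T (X x n)))\<^sup>2" unfolding X_def by (rule S_upper)
        finally show ?thesis .
      qed
      then show "\<exists>N. \<forall>n\<ge>N. (\<Sum>u\<in>F. 2 * (W (\<sigma> n) u * (1 - cos (2 * pi * (ivec u \<bullet> X x n))))) \<le> (norm (T (X x n)))\<^sup>2"
        by blast
    qed
    show "\<exists>F. finite F \<and> m x \<le> (\<Sum>u\<in>F. 2 * (w u * (1 - cos (2 * pi * (ivec u \<bullet> x))))) + \<epsilon>"
      if "0 < \<epsilon>" for x and \<epsilon> :: real
    proof -
      have c0: "0 \<le> c" by (simp add: c_def sum_nonneg)
      obtain N :: nat where N: "4 * c / \<epsilon> < real N" using reals_Archimedean2 by blast
      have "0 \<le> 4 * c / \<epsilon>" using c0 that by simp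
      then have N0: "0 < real N" "N > 0" using N by linarith+
      then have "real N \<le> (real N)\<^sup>2" by (simp add: power2_eq_square)
      with N have "4 * c / \<epsilon> \<le> (real N)\<^sup>2" by linarith
      then have tail_bound: "4 * c / (real N)\<^sup>2 \<le> \<epsilon>"
        using that N0 by (simp add: field_simps)
      define F where "F = (box_grid N :: ('n \<Rightarrow> int) set)"
      have "m (X x n) \<le> (\<Sum>u\<in>F. 2 * (W (\<sigma> n) u * (1 - cos (2 * pi * (ivec u \<bullet> X x n))))) + \<epsilon>" for n
      proof -
        define G where "G = (box_grid (\<sigma> n) :: ('n \<Rightarrow> int) set)"
        define f where "f u = 2 * (W (\<sigma> n) u * (1 - cos (2 * pi * (ivec u \<bullet> X x n))))" for u
        have f0: "0 \<le> f u" for u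
          by (auto simp: f_def intro!: mult_nonneg_nonneg W0 one_minus_cos_bounds)
        have "m (X x n) \<le> S (\<sigma> n) (approx x (\<sigma> n))" unfolding X_def by (rule S_lower)
        also have "\<dots> = (\<Sum>u\<in>G. f u)" unfolding S_W G_def f_def X_def ..
        also have "\<dots> = (\<Sum>u\<in>G \<inter> F. f u) + (\<Sum>u\<in>G - F. f u)"
          by (simp add: G_def sum.Int_Diff[symmetric])
        finally have split: "m (X x n) \<le> (\<Sum>u\<in>G \<inter> F. f u) + (\<Sum>u\<in>G - F. f u)" .
        have head: "(\<Sum>u\<in>G \<inter> F. f u) \<le> (\<Sum>u\<in>F. f u)"
          using f0 by (intro sum_mono2) (auto simp: F_def)
        have "(\<Sum>u\<in>G - F. f u) \<le> (\<Sum>u\<in>G - F. 4 / (real N)\<^sup>2 * (W (\<sigma> n) u * (norm (ivec u :: real^'n))\<^sup>2))"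
        proof (rule sum_mono)
          fix u assume "u \<in> G - F"
          then have "(real N)\<^sup>2 \<le> (norm (ivec u :: real^'n))\<^sup>2"
            by (intro norm_ivec_outside_box) (simp add: F_def)
          then have "1 \<le> (norm (ivec u :: real^'n))\<^sup>2 / (real N)\<^sup>2" using N0 by simp
          then have "4 * W (\<sigma> n) u * 1 \<le> 4 * W (\<sigma> n) u * ((norm (ivec u :: real^'n))\<^sup>2 / (real N)\<^sup>2)"
            using W0 by (intro mult_left_mono) auto
          moreover have "f u \<le> 2 * (W (\<sigma> n) u * 2)"
            unfolding f_def by (intro mult_left_mono one_minus_cos_bounds W0) auto
          ultimately show "f u \<le> 4 / (real N)\<^sup>2 * (W (\<sigma> n) u * (norm (ivec u :: real^'n))\<^sup>2)"
            by simp
        qed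
        also have "\<dots> = 4 / (real N)\<^sup>2 * (\<Sum>u\<in>G - F. W (\<sigma> n) u * (norm (ivec u :: real^'n))\<^sup>2)"
          by (rule sum_distrib_left[symmetric])
        also have "\<dots> \<le> 4 / (real N)\<^sup>2 * c"
          by (intro mult_left_mono W_tight) (auto simp: G_def)
        also have "\<dots> \<le> \<epsilon>" using tail_bound by simp
        finally show ?thesis using split head by (simp add: f_def)
      qed
      moreover have "(\<lambda>n. m (X x n)) \<longlonglongrightarrow> m x"
        using m_cont by (intro isCont_tendsto_compose[of x m] X) (simp add: continuous_on_eq_continuous_at)
      ultimately have "m x \<le> (\<Sum>u\<in>F. 2 * (w u * (1 - cos (2 * pi * (ivec u \<bullet> x))))) + \<epsilon>"
        by (intro LIMSEQ_le[of "\<lambda>n. m (X x n)" _ "\<lambda>n. (\<Sum>u\<in>F. 2 * (W (\<sigma> n) u * (1 - cos (2 * pi * (ivec u \<bullet> X x n))))) + \<epsilon>"]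
            tendsto_add partial tendsto_const) auto
      then show ?thesis by (intro exI[of _ F]) (simp add: F_def)
    qed
  qed
qed

section \<open>The primal feasible point given by an embedding\<close>

context complex_hilbert_space
begin

lemma cinner_zero: "w \<in> carrier H \<Longrightarrow> cinner H \<zero> w = 0"
  using cinner_add[of \<zero> \<zero> w] by simp

lemma cinner_minus:
  assumes "x \<in> carrier H" "w \<in> carrier H"
  shows "cinner H (\<ominus> x) w = - cinner H x w"
  using cinner_add[of x "\<ominus> x" w] assms by (simp add: r_neg cinner_zero add_eq_0_iff)

lemma cinner_diff:
  assumes "x \<in> carrier H" "y \<in> carrier H" "w \<in> carrier H"
  shows "cinner H (x \<ominus> y) w = cinner H x w - cinner H y w"
  using assms by (simp add: a_minus_def cinner_add cinner_minus)

lemma cnorm_diff_squared: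
  assumes "x \<in> carrier H" "y \<in> carrier H"
  shows "(cnorm H (x \<ominus> y))\<^sup>2 = Re (cinner H x x) + Re (cinner H y y) - 2 * Re (cinner H x y)"
proof -
  have xy: "x \<ominus> y \<in> carrier H" using assms by simp
  have "cinner H (x \<ominus> y) (x \<ominus> y) = cinner H x (x \<ominus> y) - cinner H y (x \<ominus> y)"
    using assms xy by (intro cinner_diff)
  also have "cinner H x (x \<ominus> y) = cnj (cinner H x x - cinner H y x)"
    using assms xy by (subst cinner_commute) (simp_all add: cinner_diff)
  also have "cinner H y (x \<ominus> y) = cnj (cinner H x y - cinner H y y)"
    using assms xy by (subst cinner_commute) (simp_all add: cinner_diff)
  finally have "Re (cinner H (x \<ominus> y) (x \<ominus> y)) =
      Re (cinner H x x) + Re (cinner H y y) - Re (cinner H x y) - Re (cinner H y x)"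
    by simp
  moreover have "Re (cinner H y x) = Re (cinner H x y)"
    by (subst cinner_commute[OF assms(2,1)]) simp
  ultimately show ?thesis
    using cinner_nonneg[OF xy] by (simp add: cnorm_def)
qed

lemma cnorm_diff_pos:
  assumes "x \<in> carrier H" "y \<in> carrier H" "x \<noteq> y"
  shows "0 < cnorm H (x \<ominus> y)"
proof -
  have xy: "x \<ominus> y \<in> carrier H" using assms by simp
  have x_eq: "x = (x \<ominus> y) \<oplus> y" using assms by (simp add: a_minus_def a_assoc l_neg)
  have "x \<ominus> y \<noteq> \<zero>"
  proof
    assume "x \<ominus> y = \<zero>"
    with x_eq assms show False by simp
  qed
  have "Im (cinner H (x \<ominus> y) (x \<ominus> y)) = 0"
    using arg_cong[OF cinner_commute[OF xy xy], of Im] by simp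
  moreover have "cinner H (x \<ominus> y) (x \<ominus> y) \<noteq> 0"
    using cinner_definite[OF xy] \<open>x \<ominus> y \<noteq> \<zero>\<close> by blast
  ultimately have "Re (cinner H (x \<ominus> y) (x \<ominus> y)) \<noteq> 0" by (simp add: complex_eq_iff)
  then show ?thesis using cinner_nonneg[OF xy] by (simp add: cnorm_def)
qed

text \<open>The double sum is the squared norm of \<open>\<Sum> c\<^sub>a \<psi>\<^sub>a\<close>. This vector is obtained by induction, through
  its inner products with all other vectors.\<close>

lemma gram_nonneg:
  assumes "finite A" "\<And>a. a \<in> A \<Longrightarrow> \<psi> a \<in> carrier H"
  shows "0 \<le> (\<Sum>a\<in>A. \<Sum>b\<in>A. c a * c b * Re (cinner H (\<psi> a) (\<psi> b)))"
proof -
  have "\<exists>v\<in>carrier H. \<forall>w\<in>carrier H. cinner H v w = (\<Sum>a\<in>A. complex_of_real (c a) * cinner H (\<psi> a) w)"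
    using assms
  proof (induction A rule: finite_induct)
    case empty
    show ?case by (auto simp: cinner_zero intro!: bexI[of _ \<zero>])
  next
    case (insert x A)
    then obtain v where v: "v \<in> carrier H"
      "\<And>w. w \<in> carrier H \<Longrightarrow> cinner H v w = (\<Sum>a\<in>A. complex_of_real (c a) * cinner H (\<psi> a) w)"
      by auto
    have x: "\<psi> x \<in> carrier H" using insert.prems by simp
    have cx: "complex_of_real (c x) \<odot> \<psi> x \<in> carrier H"
      using x by (intro smult_closed) (simp_all add: carrier_class)
    show ?case
    proof (intro bexI ballI)
      show "(complex_of_real (c x) \<odot> \<psi> x) \<oplus> v \<in> carrier H" using cx v(1) by simp
      fix w assume w: "w \<in> carrier H"
      show "cinner H ((complex_of_real (c x) \<odot> \<psi> x) \<oplus> v) w =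
          (\<Sum>a\<in>insert x A. complex_of_real (c a) * cinner H (\<psi> a) w)"
        using insert.hyps v(2)[OF w] by (simp add: cinner_add[OF cx v(1) w] cinner_smult[OF x w])
    qed
  qed
  then obtain v where v: "v \<in> carrier H"
    "\<And>w. w \<in> carrier H \<Longrightarrow> cinner H v w = (\<Sum>a\<in>A. complex_of_real (c a) * cinner H (\<psi> a) w)"
    by blast
  have "Re (cinner H (\<psi> a) v) = (\<Sum>b\<in>A. c b * Re (cinner H (\<psi> a) (\<psi> b)))" if "a \<in> A" for a
  proof -
    have "Re (cinner H (\<psi> a) v) = Re (cinner H v (\<psi> a))"
      by (subst cinner_commute) (simp_all add: assms(2)[OF that] v(1))
    also have "\<dots> = (\<Sum>b\<in>A. c b * Re (cinner H (\<psi> b) (\<psi> a)))"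
      by (simp add: v(2) assms(2)[OF that])
    also have "\<dots> = (\<Sum>b\<in>A. c b * Re (cinner H (\<psi> a) (\<psi> b)))"
      using assms(2) that by (intro sum.cong refl) (subst cinner_commute, simp_all)
    finally show ?thesis .
  qed
  then have "Re (cinner H v v) = (\<Sum>a\<in>A. \<Sum>b\<in>A. c a * c b * Re (cinner H (\<psi> a) (\<psi> b)))"
    by (simp add: v(2)[OF v(1)] sum_distrib_left mult.assoc)
  then show ?thesis using cinner_nonneg[OF v(1)] by simp
qed

end

lemma norm_outer: "norm (outer u) = (norm u)\<^sup>2"
proof -
  have row: "outer u $ i = u $ i *\<^sub>R u" for i by (simp add: outer_def vec_eq_iff)
  have "norm (outer u) = L2_set (\<lambda>i. norm (outer u $ i)) UNIV" by (rule norm_vec_def)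
  also have "\<dots> = L2_set (\<lambda>i. norm u * norm (u $ i)) UNIV"
    by (simp only: row norm_scaleR real_norm_def mult.commute)
  also have "\<dots> = norm u * L2_set (\<lambda>i. norm (u $ i)) UNIV"
    by (rule L2_set_right_distrib[symmetric]) simp
  also have "L2_set (\<lambda>i. norm (u $ i)) UNIV = norm u" by (rule norm_vec_def[symmetric])
  finally show ?thesis by (simp add: power2_eq_square)
qed

lemma transpose_slack_matrix:
  assumes "(\<lambda>u. z u *\<^sub>R outer u) summable_on dual_lattice L"
  shows "transpose (slack_matrix L C z) = slack_matrix L C z"
proof -
  define Z where "Z = (\<Sum>\<^sub>\<infinity>u\<in>dual_lattice L. z u *\<^sub>R outer u)"
  have bl: "bounded_linear (transpose :: real^'a^'a \<Rightarrow> real^'a^'a)"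
    by (intro linear_conv_bounded_linear[THEN iffD1] linearI) (simp_all add: transpose_def vec_eq_iff)
  interpret t: bounded_linear "transpose :: real^'a^'a \<Rightarrow> real^'a^'a" by (rule bl)
  have Z: "((\<lambda>u. z u *\<^sub>R outer u) has_sum Z) (dual_lattice L)"
    using assms by (simp add: Z_def)
  have "((\<lambda>u. z u *\<^sub>R outer u) has_sum transpose Z) (dual_lattice L)"
    using has_sum_bounded_linear[OF bl Z] by (simp add: t.scaleR)
  then have "transpose Z = Z" using Z by (rule has_sum_unique)
  then show ?thesis
    by (simp add: slack_matrix_def Z_def[symmetric] t.diff t.scaleR)
qed

lemma INF_norm_eq_infdist:
  assumes "L \<noteq> {}"
  shows "(INF v\<in>L. norm (x - v)) = infdist x L"
  using assms by (simp add: infdist_def dist_norm)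

lemma infdist_lattice_voronoi:
  assumes "is_lattice L" "x \<in> voronoi_cell L"
  shows "infdist x L = norm x"
proof -
  have "(INF v\<in>L. norm (x - v)) = norm x"
    using assms(2) lattice_zero[OF assms(1)]
    by (intro cInf_eq_minimum) (auto simp: voronoi_cell_def intro: image_eqI[of _ _ 0])
  then show ?thesis
    using lattice_zero[OF assms(1)] by (subst INF_norm_eq_infdist[symmetric]) auto
qed

text \<open>In lattice coordinates the real part of the Gram kernel is periodic under integer vectors, so its
  spectrum \<open>w\<close> exists; \<open>z = B\<^sup>2 w\<close> is the required point. The lower distortion bound gives the
  constraint on the Voronoi cell, where the distance to \<open>L\<close> is the norm. The upper bound gives the matrix
  constraint in the limit of small displacements, where \<open>2 (1 - cos t)\<close> is \<open>t\<^sup>2\<close> up to fourth order.\<close>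

proposition embedding_imp_primal_feasible:
  fixes L :: "(real^'n) set"
  assumes L: "is_lattice L" and emb: "euclidean_embedding L H \<phi>"
    and A0: "0 \<le> A" and B0: "0 < B"
    and lip: "\<And>X Y. X \<in> torus L \<Longrightarrow> Y \<in> torus L \<Longrightarrow> X \<noteq> Y \<Longrightarrow>
        cnorm H (\<phi> X \<ominus>\<^bsub>H\<^esub> \<phi> Y) \<le> A * torus_dist L X Y"
    and colip: "\<And>X Y. X \<in> torus L \<Longrightarrow> Y \<in> torus L \<Longrightarrow> X \<noteq> Y \<Longrightarrow>
        torus_dist L X Y \<le> B * cnorm H (\<phi> X \<ominus>\<^bsub>H\<^esub> \<phi> Y)"
  shows "\<exists>z. primal_feasible L (A\<^sup>2 * B\<^sup>2) z"
proof -
  interpret complex_hilbert_space H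
    using emb by (simp add: euclidean_embedding_def)
  obtain T S :: "real^'n \<Rightarrow> real^'n" where T: "linear T" "inj T" "surj T"
    and S: "linear S" "inj S" and LT: "L = T ` int_vectors"
    and LS: "dual_lattice L = S ` int_vectors" and ST: "\<And>p q. S p \<bullet> T q = p \<bullet> q"
    using lattice_coordinates[OF L] by metis
  have L0: "L \<noteq> {}" using lattice_zero[OF L] by auto
  define cl where "cl x = torus_rel L `` {x}" for x
  have cl_torus: "cl x \<in> torus L" for x
    unfolding cl_def torus_def by (intro quotientI) simp
  have dist_cl: "torus_dist L (cl x) (cl y) = infdist (x - y) L" for x y
    unfolding cl_def torus_dist_class[OF L] by (rule INF_norm_eq_infdist[OF L0])
  define \<psi> where "\<psi> x = \<phi> (cl x)" for x
  have \<psi>: "\<psi> x \<in> carrier H" for x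
    using emb cl_torus by (auto simp: euclidean_embedding_def \<psi>_def)
  define N where "N x y = cnorm H (\<psi> x \<ominus>\<^bsub>H\<^esub> \<psi> y)" for x y
  have N2: "(N x y)\<^sup>2 = Re (cinner H (\<psi> x) (\<psi> x)) + Re (cinner H (\<psi> y) (\<psi> y)) - 2 * Re (cinner H (\<psi> x) (\<psi> y))" for x y
    unfolding N_def by (rule cnorm_diff_squared[OF \<psi> \<psi>])
  have N0: "0 \<le> N x y" for x y
    unfolding N_def cnorm_def by (simp add: cinner_nonneg \<psi>)
  have N_eq: "N x y = 0 \<and> infdist (x - y) L = 0" if "cl x = cl y" for x y
  proof -
    have "(N x y)\<^sup>2 = 0" using that unfolding N2 by (simp add: \<psi>_def)
    moreover have "x - y \<in> L" using that by (simp add: cl_def torus_classes_eq_iff[OF L])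
    ultimately show ?thesis by simp
  qed
  have N_le: "N x y \<le> A * norm (x - y)" for x y
  proof (cases "cl x = cl y")
    case True
    then show ?thesis using N_eq[OF True] A0 by simp
  next
    case False
    have "N x y \<le> A * infdist (x - y) L"
      using lip[OF cl_torus cl_torus False] by (simp add: N_def \<psi>_def dist_cl)
    also have "\<dots> \<le> A * norm (x - y)"
      using A0 infdist_le[OF lattice_zero[OF L], of "x - y"] by (intro mult_left_mono) auto
    finally show ?thesis .
  qed
  have N_ge: "infdist (x - y) L \<le> B * N x y" for x y
  proof (cases "cl x = cl y")
    case True
    then show ?thesis using N_eq[OF True] by simp
  next
    case False
    then show ?thesis
      using colip[OF cl_torus cl_torus False] by (simp add: N_def \<psi>_def dist_cl)
  qed

  define k where "k p q = Re (cinner H (\<psi> (T p)) (\<psi> (T q)))" for p q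
  define m where "m p = (infdist (T p) L)\<^sup>2 / B\<^sup>2" for p
  have kN: "k p p + k q q - 2 * k p q = (N (T p) (T q))\<^sup>2" for p q
    unfolding k_def N2 ..
  obtain w c where w0: "\<And>u. 0 \<le> w u" and w_sym: "\<And>u. w (\<lambda>i. - u i) = w u"
    and w_tight: "\<And>F. finite F \<Longrightarrow> (\<Sum>u\<in>F. w u * (norm (ivec u :: real^'n))\<^sup>2) \<le> c"
    and w_sum: "\<And>F. finite F \<Longrightarrow> (\<Sum>u\<in>F. w u) \<le> c"
    and w_upper: "\<And>F x. finite F \<Longrightarrow>
        (\<Sum>u\<in>F. 2 * (w u * (1 - cos (2 * pi * (ivec u \<bullet> x))))) \<le> (norm (A *\<^sub>R T x))\<^sup>2"
    and w_lower: "\<And>x \<epsilon>. 0 < \<epsilon> \<Longrightarrow>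
        \<exists>F. finite F \<and> m x \<le> (\<Sum>u\<in>F. 2 * (w u * (1 - cos (2 * pi * (ivec u \<bullet> x))))) + \<epsilon>"
  proof (rule periodic_kernel_spectrum[of k "\<lambda>x. A *\<^sub>R T x" m])
    fix x y v :: "real^'n" assume "v \<in> int_vectors"
    then have "T (x + v) - T x \<in> L" by (auto simp: LT linear_add[OF T(1)])
    then have "cl (T (x + v)) = cl (T x)"
      by (simp add: cl_def torus_classes_eq_iff[OF L])
    then show "k (x + v) y = k x y" by (simp add: k_def \<psi>_def)
  next
    fix x y show "k x y = k y x"
      unfolding k_def by (subst cinner_commute[OF \<psi> \<psi>]) simp
  next
    fix A :: "(real^'n) set" and c :: "real^'n \<Rightarrow> real" assume "finite A"
    then show "0 \<le> (\<Sum>x\<in>A. \<Sum>y\<in>A. c x * c y * k x y)"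
      unfolding k_def by (rule gram_nonneg) (rule \<psi>)
  next
    show "linear (\<lambda>x. A *\<^sub>R T x)"
      using T(1) by (rule linear_compose_scale_right)
  next
    fix x y show "k x x + k y y - 2 * k x y \<le> (norm (A *\<^sub>R T (x - y)))\<^sup>2"
      unfolding kN using N_le[of "T x" "T y"] N0 A0
      by (intro power_mono) (simp_all add: linear_diff[OF T(1)])
  next
    fix x y
    have "(infdist (T x - T y) L)\<^sup>2 \<le> (B * N (T x) (T y))\<^sup>2"
      by (intro power_mono N_ge) (simp add: infdist_nonneg)
    then show "m (x - y) \<le> k x x + k y y - 2 * k x y"
      unfolding kN m_def using B0
      by (simp add: linear_diff[OF T(1)] power_mult_distrib divide_le_eq mult.commute)
  next
    show "continuous_on UNIV m"
      unfolding m_def using T(1) B0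
      by (intro continuous_intros linear_continuous_on) (auto simp: linear_conv_bounded_linear)
  qed (rule that)

  define e where "e p = S (ivec p :: real^'n)" for p
  have inj_e: "inj e"
  proof (rule injI)
    fix p q assume "e p = e q"
    then have "ivec p = (ivec q :: real^'n)" unfolding e_def by (rule injD[OF S(2)])
    then show "p = q" by (auto simp: ivec_def vec_eq_iff)
  qed
  have bij: "bij_betw e UNIV (dual_lattice L)"
    using inj_e unfolding bij_betw_def LS int_vectors_conv_range ivec_def e_def by (auto simp: image_image)
  have e_inner: "e p \<bullet> T t = ivec p \<bullet> t" for p t by (simp add: e_def ST)
  define z where "z u = B\<^sup>2 * w (inv_into UNIV e u)" for u
  have z_e: "z (e p) = B\<^sup>2 * w p" for p by (simp add: z_def inv_f_f[OF inj_e])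
  have z0: "0 \<le> z u" for u by (simp add: z_def w0)
  have summ: "f summable_on dual_lattice L"
    if "\<And>p. 0 \<le> f (e p)" "\<And>F. finite F \<Longrightarrow> (\<Sum>p\<in>F. f (e p)) \<le> K" for f :: "real^'n \<Rightarrow> real" and K
  proof -
    have "(\<lambda>p. f (e p)) summable_on UNIV"
      using that by (intro nonneg_bdd_above_summable_on bdd_aboveI2[where M = K]) auto
    then show ?thesis by (simp add: summable_on_reindex_bij_betw[OF bij])
  qed
  have z_abs: "(\<lambda>u. \<bar>z u\<bar>) summable_on dual_lattice L"
  proof (rule summ)
    fix F :: "('n \<Rightarrow> int) set" assume "finite F"
    from mult_left_mono[OF w_sum[OF this], of "B\<^sup>2"]
    show "(\<Sum>p\<in>F. \<bar>z (e p)\<bar>) \<le> B\<^sup>2 * c" by (simp add: z_e w0 sum_distrib_left)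
  qed simp
  obtain K where K: "0 < K" "\<And>x. norm (S x) \<le> norm x * K"
    using linear_bounded_pos[OF S(1)] by (metis mult.commute)
  have "(\<lambda>u. norm (z u *\<^sub>R outer u)) summable_on dual_lattice L"
  proof (rule summ)
    fix F :: "('n \<Rightarrow> int) set" assume F: "finite F"
    have "(\<Sum>p\<in>F. norm (z (e p) *\<^sub>R outer (e p))) \<le> (\<Sum>p\<in>F. (B\<^sup>2 * K\<^sup>2) * (w p * (norm (ivec p :: real^'n))\<^sup>2))"
    proof (rule sum_mono)
      fix p :: "'n \<Rightarrow> int"
      have "(norm (e p))\<^sup>2 \<le> (norm (ivec p :: real^'n) * K)\<^sup>2"
        unfolding e_def by (intro power_mono K) simp
      then have "B\<^sup>2 * w p * (norm (e p))\<^sup>2 \<le> B\<^sup>2 * w p * (norm (ivec p :: real^'n) * K)\<^sup>2"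
        by (intro mult_left_mono) (simp_all add: w0)
      then show "norm (z (e p) *\<^sub>R outer (e p)) \<le> (B\<^sup>2 * K\<^sup>2) * (w p * (norm (ivec p :: real^'n))\<^sup>2)"
        by (simp add: norm_outer z_e w0 power_mult_distrib mult_ac)
    qed
    also have "\<dots> \<le> (B\<^sup>2 * K\<^sup>2) * c"
      unfolding sum_distrib_left[symmetric] by (intro mult_left_mono w_tight F) simp
    finally show "(\<Sum>p\<in>F. norm (z (e p) *\<^sub>R outer (e p))) \<le> (B\<^sup>2 * K\<^sup>2) * c" .
  qed simp
  then have z_outer: "(\<lambda>u. z u *\<^sub>R outer u) summable_on dual_lattice L"
    by (rule abs_summable_summable)

  have "primal_feasible L (A\<^sup>2 * B\<^sup>2) z"
    unfolding primal_feasible_def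
  proof (intro conjI ballI)
    fix u assume "u \<in> dual_lattice L"
    then obtain p where p: "u = e p" using bij by (auto simp: bij_betw_def)
    have "- e p = e (\<lambda>i. - p i)"
    proof -
      have "ivec (\<lambda>i. - p i) = - (ivec p :: real^'n)" by (simp add: ivec_def vec_eq_iff)
      then show ?thesis by (simp add: e_def linear_neg[OF S(1)])
    qed
    then show "z u = z (- u)" by (simp add: p z_e w_sym)
  next
    fix x assume x: "x \<in> voronoi_cell L"
    obtain t where t: "x = T t" using T(3) by (metis surjD)
    have cs: "((\<lambda>p. 2 * (z (e p) * (1 - cos (2 * pi * (e p \<bullet> x))))) has_sum cos_series L z x) UNIV"
      using cos_series_has_sum[OF z_abs z0, of x] by (subst has_sum_reindex_bij_betw[OF bij])
    show "(norm x)\<^sup>2 \<le> cos_series L z x"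
    proof (rule field_le_epsilon)
      fix \<epsilon> :: real assume "0 < \<epsilon>"
      then have "0 < \<epsilon> / B\<^sup>2" using B0 by simp
      from w_lower[OF this, of t] obtain F where F: "finite F"
        "m t \<le> (\<Sum>u\<in>F. 2 * (w u * (1 - cos (2 * pi * (ivec u \<bullet> t))))) + \<epsilon> / B\<^sup>2" by blast
      have "(norm x)\<^sup>2 = B\<^sup>2 * m t"
        using B0 infdist_lattice_voronoi[OF L x] by (simp add: m_def t)
      also have "\<dots> \<le> B\<^sup>2 * ((\<Sum>u\<in>F. 2 * (w u * (1 - cos (2 * pi * (ivec u \<bullet> t))))) + \<epsilon> / B\<^sup>2)"
        by (intro mult_left_mono F) simp
      also have "\<dots> = (\<Sum>p\<in>F. 2 * (z (e p) * (1 - cos (2 * pi * (e p \<bullet> x))))) + \<epsilon>"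
      proof -
        have "B\<^sup>2 * (\<Sum>u\<in>F. 2 * (w u * (1 - cos (2 * pi * (ivec u \<bullet> t))))) =
            (\<Sum>p\<in>F. 2 * (z (e p) * (1 - cos (2 * pi * (e p \<bullet> x)))))"
          unfolding sum_distrib_left by (intro sum.cong refl) (simp only: z_e t e_inner mult_ac)
        then show ?thesis using B0 by (simp add: distrib_left)
      qed
      also have "\<dots> \<le> cos_series L z x + \<epsilon>"
        using F(1) by (intro add_right_mono finite_sum_le_has_sum[OF cs])
          (auto intro!: mult_nonneg_nonneg z0 one_minus_cos_bounds)
      finally show "(norm x)\<^sup>2 \<le> cos_series L z x + \<epsilon>" .
    qed
  next
    show "psd (slack_matrix L (A\<^sup>2 * B\<^sup>2) z)"
      unfolding psd_def
    proof (intro conjI allI transpose_slack_matrix z_outer)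
      fix x
      obtain t where t: "x = T t" using T(3) by (metis surjD)
      define y where "y p = 2 * pi * (ivec p \<bullet> t)" for p
      have w_quad: "(\<Sum>p\<in>F. w p * (y p)\<^sup>2) \<le> A\<^sup>2 * (norm x)\<^sup>2" if F: "finite F" for F
      proof (rule field_le_epsilon)
        fix \<epsilon> :: real assume \<epsilon>: "0 < \<epsilon>"
        define R where "R = (\<Sum>p\<in>F. w p * (y p) ^ 4 / 12)"
        have R0: "0 \<le> R" unfolding R_def by (intro sum_nonneg) (simp add: w0)
        \<comment> \<open>Evaluate the upper bound at \<open>s t\<close> with \<open>s\<close> so small that the quartic error \<open>s\<^sup>2 R\<close> is at most \<open>\<epsilon>\<close>.\<close>
        define s where "s = sqrt (\<epsilon> / (R + 1))"
        have s2: "s\<^sup>2 = \<epsilon> / (R + 1)" using \<epsilon> R0 by (simp add: s_def)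
        have s0: "0 < s\<^sup>2" using \<epsilon> R0 by (simp add: s2)
        have "s\<^sup>2 * ((\<Sum>p\<in>F. w p * (y p)\<^sup>2) - s\<^sup>2 * R) = (\<Sum>p\<in>F. w p * ((s * y p)\<^sup>2 - (s * y p) ^ 4 / 12))"
          by (simp add: R_def right_diff_distrib sum_distrib_left sum_subtractf power_mult_distrib
              power2_eq_square power4_eq_xxxx mult_ac)
        also have "\<dots> \<le> (\<Sum>p\<in>F. 2 * (w p * (1 - cos (2 * pi * (ivec p \<bullet> (s *\<^sub>R t))))))"
        proof (rule sum_mono)
          fix p
          have sy: "2 * pi * (ivec p \<bullet> (s *\<^sub>R t)) = s * y p" by (simp add: y_def)
          have "w p * ((s * y p)\<^sup>2 - (s * y p) ^ 4 / 12) \<le> w p * (2 * (1 - cos (s * y p)))"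
            using cos_le_quartic[of "s * y p"] by (intro mult_left_mono w0) simp
          then show "w p * ((s * y p)\<^sup>2 - (s * y p) ^ 4 / 12) \<le> 2 * (w p * (1 - cos (2 * pi * (ivec p \<bullet> (s *\<^sub>R t)))))"
            unfolding sy by (simp only: mult.left_commute)
        qed
        also have "\<dots> \<le> (norm (A *\<^sub>R T (s *\<^sub>R t)))\<^sup>2" by (rule w_upper[OF F])
        also have "\<dots> = s\<^sup>2 * (A\<^sup>2 * (norm x)\<^sup>2)"
          by (simp add: t linear_scale[OF T(1)] power_mult_distrib)
        finally have "(\<Sum>p\<in>F. w p * (y p)\<^sup>2) - s\<^sup>2 * R \<le> A\<^sup>2 * (norm x)\<^sup>2"
          using s0 by (simp only: mult_le_cancel_left_pos)
        moreover have "s\<^sup>2 * R \<le> \<epsilon>" using \<epsilon> R0 by (simp add: s2 divide_le_eq mult_left_mono)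
        ultimately show "(\<Sum>p\<in>F. w p * (y p)\<^sup>2) \<le> A\<^sup>2 * (norm x)\<^sup>2 + \<epsilon>" by linarith
      qed
      have q: "((\<lambda>p. 4 * pi\<^sup>2 * z (e p) * (e p \<bullet> x)\<^sup>2) has_sum
          (A\<^sup>2 * B\<^sup>2 * (norm x)\<^sup>2 - x \<bullet> (slack_matrix L (A\<^sup>2 * B\<^sup>2) z *v x))) UNIV"
        using slack_quadratic[OF z_outer] by (subst has_sum_reindex_bij_betw[OF bij])
      have "A\<^sup>2 * B\<^sup>2 * (norm x)\<^sup>2 - x \<bullet> (slack_matrix L (A\<^sup>2 * B\<^sup>2) z *v x) \<le> B\<^sup>2 * (A\<^sup>2 * (norm x)\<^sup>2)"
      proof (rule has_sum_le_finite_sums[OF q])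
        fix F :: "('n \<Rightarrow> int) set" assume "finite F"
        have "(\<Sum>p\<in>F. 4 * pi\<^sup>2 * z (e p) * (e p \<bullet> x)\<^sup>2) = B\<^sup>2 * (\<Sum>p\<in>F. w p * (y p)\<^sup>2)"
          by (simp add: sum_distrib_left z_e y_def t e_inner power_mult_distrib mult_ac)
        also have "\<dots> \<le> B\<^sup>2 * (A\<^sup>2 * (norm x)\<^sup>2)"
          by (intro mult_left_mono w_quad \<open>finite F\<close>) simp
        finally show "(\<Sum>p\<in>F. 4 * pi\<^sup>2 * z (e p) * (e p \<bullet> x)\<^sup>2) \<le> B\<^sup>2 * (A\<^sup>2 * (norm x)\<^sup>2)" .
      qed
      then show "0 \<le> x \<bullet> (slack_matrix L (A\<^sup>2 * B\<^sup>2) z *v x)" by (simp add: mult_ac)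
    qed
  qed (use z_abs z_outer z0 in auto)
  then show ?thesis by blast
qed

section \<open>The least distortion between the two programs\<close>

lemma ennreal_power2_le_imp_le:
  assumes "(x :: ennreal)\<^sup>2 \<le> y\<^sup>2"
  shows "x \<le> y"
proof (cases "y = \<infinity>")
  case False
  then have "x \<noteq> \<infinity>" using assms by (auto simp: power_eq_top_ennreal top_unique)
  with False obtain a b where ab: "x = ennreal a" "0 \<le> a" "y = ennreal b" "0 \<le> b"
    by (metis ennreal_cases infinity_ennreal_def)
  then have "a\<^sup>2 \<le> b\<^sup>2" using assms by (simp add: ennreal_power)
  then show ?thesis using ab by (auto intro: ennreal_leI power2_le_imp_le)
qed simp

text \<open>An embedding with infinite distortion bounds nothing. For any other one, both suprema in the
  distortion are finite: they are positive because the torus has two distinct points, so neither can be infinite while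
  the product is finite. They serve as the constants \<open>A\<close> and \<open>B\<close> of the primal feasible
  point. Finally, the square of the infimum is compared through a square root of the dual value.\<close>

proposition dual_value_le_least_distortion:
  fixes L :: "(real^'n) set"
  assumes L: "is_lattice L" and dual: "dual_feasible L \<nu> Y"
  shows "dual_value L \<nu> \<le> (least_distortion TYPE('h) L)\<^sup>2"
proof -
  have main: "dual_value L \<nu> \<le> (distortion L H \<phi>)\<^sup>2"
    if emb: "euclidean_embedding L H \<phi>" for H :: "'h cinner_space" and \<phi>
  proof (cases "distortion L H \<phi> = \<infinity>")
    case False
    interpret complex_hilbert_space H
      using emb by (simp add: euclidean_embedding_def)
    define P where "P = {(X, Y). X \<in> torus L \<and> Y \<in> torus L \<and> X \<noteq> Y}"
    define a where "a = (SUP (X, Y) \<in> P. ennreal (cnorm H (\<phi> X \<ominus>\<^bsub>H\<^esub> \<phi> Y) / torus_dist L X Y))"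
    define b where "b = (SUP (X, Y) \<in> P. ennreal (torus_dist L X Y / cnorm H (\<phi> X \<ominus>\<^bsub>H\<^esub> \<phi> Y)))"
    have ab: "distortion L H \<phi> = a * b"
      by (simp add: distortion_def a_def b_def P_def)
    have pos: "0 < cnorm H (\<phi> X \<ominus>\<^bsub>H\<^esub> \<phi> Y)" "0 < torus_dist L X Y" if "(X, Y) \<in> P" for X Y
    proof -
      have XY: "X \<in> torus L" "Y \<in> torus L" "X \<noteq> Y" using that by (auto simp: P_def)
      then have c: "\<phi> X \<in> carrier H" "\<phi> Y \<in> carrier H" "\<phi> X \<noteq> \<phi> Y"
        using emb by (auto simp: euclidean_embedding_def inj_on_def)
      show "0 < cnorm H (\<phi> X \<ominus>\<^bsub>H\<^esub> \<phi> Y)" using c by (rule cnorm_diff_pos)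
      obtain v where v: "v \<in> L" "torus_dist L X Y = norm ((SOME x. x \<in> X) - (SOME y. y \<in> Y) - v)"
        using torus_dist_voronoi[OF L XY(1,2)] by metis
      have "(SOME x. x \<in> X) - (SOME y. y \<in> Y) \<noteq> v"
        using XY(3) v(1) torus_representative[OF L XY(1)] torus_representative[OF L XY(2)]
          torus_classes_eq_iff[OF L, of "SOME x. x \<in> X" "SOME y. y \<in> Y"] by metis
      then show "0 < torus_dist L X Y" by (simp add: v(2))
    qed
    have "P \<noteq> {}"
    proof -
      obtain x where x: "x \<notin> L"
      proof -
        obtain T :: "real^'n \<Rightarrow> real^'n" where T: "inj T" "L = T ` int_vectors"
          using lattice_coordinates[OF L] by metis
        \<comment> \<open>Half of the sum of the lattice basis is a point outside \<open>L\<close>.\<close>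
        have "(1/2 :: real) \<notin> \<int>"
        proof
          assume "(1/2 :: real) \<in> \<int>"
          then obtain k where "(1/2 :: real) = of_int k" by (rule Ints_cases)
          then have "(1 :: real) = of_int (2 * k)" by simp
          then have "1 = 2 * k" by (simp only: of_int_eq_1_iff)
          then show False by presburger
        qed
        then have "((\<chi> i. 1/2) :: real^'n) \<notin> int_vectors" by (simp add: int_vectors_def)
        then have "T (\<chi> i. 1/2) \<notin> L" by (simp add: T inj_image_mem_iff)
        then show thesis by (rule that)
      qed
      have "(torus_rel L `` {x}, torus_rel L `` {0}) \<in> P"
        using x torus_classes_eq_iff[OF L, of x 0]
        by (auto simp: P_def torus_def intro!: quotientI)
      then show ?thesis by blast
    qed
    then obtain X0 Y0 where XY0: "(X0, Y0) \<in> P" by auto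
    have "0 < ennreal (cnorm H (\<phi> X0 \<ominus>\<^bsub>H\<^esub> \<phi> Y0) / torus_dist L X0 Y0)"
      using pos[OF XY0] by simp
    also have "\<dots> \<le> a" unfolding a_def by (rule SUP_upper2[OF XY0]) simp
    finally have a0: "0 < a" .
    have "0 < ennreal (torus_dist L X0 Y0 / cnorm H (\<phi> X0 \<ominus>\<^bsub>H\<^esub> \<phi> Y0))"
      using pos[OF XY0] by simp
    also have "\<dots> \<le> b" unfolding b_def by (rule SUP_upper2[OF XY0]) simp
    finally have b0: "0 < b" .
    have "a \<noteq> \<infinity>" "b \<noteq> \<infinity>"
      using False a0 b0 unfolding ab by (auto simp: ennreal_mult_eq_top_iff)
    then obtain A B where AB: "a = ennreal A" "0 \<le> A" "b = ennreal B" "0 \<le> B"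
      by (metis ennreal_cases infinity_ennreal_def)
    have B0: "0 < B" using b0 AB by simp
    have "\<exists>z. primal_feasible L (A\<^sup>2 * B\<^sup>2) z"
    proof (rule embedding_imp_primal_feasible[OF L emb AB(2) B0])
      fix X Y assume "X \<in> torus L" "Y \<in> torus L" "X \<noteq> Y"
      then have XY: "(X, Y) \<in> P" by (simp add: P_def)
      have "ennreal (cnorm H (\<phi> X \<ominus>\<^bsub>H\<^esub> \<phi> Y) / torus_dist L X Y) \<le> ennreal A"
        unfolding AB(1)[symmetric] a_def by (rule SUP_upper2[OF XY]) simp
      then show "cnorm H (\<phi> X \<ominus>\<^bsub>H\<^esub> \<phi> Y) \<le> A * torus_dist L X Y"
        using pos[OF XY] AB(2) by (simp add: divide_le_eq)
      have "ennreal (torus_dist L X Y / cnorm H (\<phi> X \<ominus>\<^bsub>H\<^esub> \<phi> Y)) \<le> ennreal B"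
        unfolding AB(3)[symmetric] b_def by (rule SUP_upper2[OF XY]) simp
      then show "torus_dist L X Y \<le> B * cnorm H (\<phi> X \<ominus>\<^bsub>H\<^esub> \<phi> Y)"
        using pos[OF XY] AB(4) by (simp add: divide_le_eq)
    qed
    then obtain z where "primal_feasible L (A\<^sup>2 * B\<^sup>2) z" by blast
    from weak_duality_complementary_slackness(1)[OF L this dual]
    show ?thesis
      using AB by (simp add: ab ennreal_mult[symmetric] ennreal_power power_mult_distrib)
  qed simp
  obtain d where d: "dual_value L \<nu> = d\<^sup>2"
  proof (cases "dual_value L \<nu>")
    case (real r)
    then have "dual_value L \<nu> = (ennreal (sqrt r))\<^sup>2" by (simp add: ennreal_power)
    then show thesis by (rule that)
  next
    case top
    then have "dual_value L \<nu> = \<infinity>\<^sup>2" by simp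
    then show thesis by (rule that)
  qed
  have "d \<le> distortion L H \<phi>" if "euclidean_embedding L H \<phi>" for H :: "'h cinner_space" and \<phi>
    using main[OF that] unfolding d by (rule ennreal_power2_le_imp_le)
  then have "d \<le> least_distortion TYPE('h) L"
    unfolding least_distortion_def by (intro Inf_greatest) blast
  then show ?thesis unfolding d by (intro power_mono) auto
qed

theorem theorem2p4:
  fixes L :: "(real^'n) set" and C :: real and z :: "real^'n \<Rightarrow> real"
  assumes "is_lattice L"
    and "primal_feasible L C z"
    and "(UNIV :: real set) \<lesssim> (UNIV :: 'h set)"
  shows "ennreal C \<ge> (least_distortion TYPE('h) L)\<^sup>2 \<and>
    (least_distortion TYPE('h) L)\<^sup>2 \<ge> (SUP (\<nu>, Y) \<in> {(\<nu>, Y). dual_feasible L \<nu> Y}. dual_value L \<nu>) \<and>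
    (\<forall>\<nu> Y. dual_feasible L \<nu> Y \<longrightarrow>
      (ennreal C = dual_value L \<nu> \<longleftrightarrow>
        slack_matrix L C z ** Y = 0 \<and>
        supported_on \<nu> {x \<in> voronoi_cell L. (norm x)\<^sup>2 = cos_series L z x} \<and>
        (\<forall>u\<in>dual_lattice L. z u \<noteq> 0 \<longrightarrow>
          (\<integral>\<^sup>+x\<in>voronoi_cell L. ennreal (1 - cos (2 * pi * (u \<bullet> x))) \<partial>\<nu>) = ennreal (u \<bullet> (Y *v u)))))"
proof (intro conjI allI impI)
  show "(least_distortion TYPE('h) L)\<^sup>2 \<le> ennreal C"
    by (rule least_distortion_le_primal[OF assms])
  show "(SUP (\<nu>, Y) \<in> {(\<nu>, Y). dual_feasible L \<nu> Y}. dual_value L \<nu>) \<le> (least_distortion TYPE('h) L)\<^sup>2"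
    by (intro SUP_least) (auto intro: dual_value_le_least_distortion[OF assms(1)])
qed (rule weak_duality_complementary_slackness(2)[OF assms(1,2)])

end
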